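(* Let $(T\colon H\to B,\varphi_H)$ be a relative Rota-Baxter operator in $\mathsf{C}$ with $H$ cocommutative and such that $T\colon H\to B$ is an isomorphism. Let $\overline{\mathbb{H}}=(H,\overline{H})$ be the Hopf brace associated to $(T\colon H\to B,\varphi_H)$. Then the categories ${}_{(T,\varphi_H)}\mathsf{Mod}^{\mathsf{iso}}$ and ${}_{\overline{\mathbb{H}}}\mathsf{Mod}$ are equivalent.
   Context: $\mathsf{C}$ is a strict braided monoidal category with tensor product $\otimes$, unit object $K$ and braiding $c$. For an object $P$ and a morphism $f$, write $P\otimes f$ for $id_P\otimes f$ and $f\otimes P$ for $f\otimes id_P$. (Co)algebras, Hopf algebras and modules are taken in $\mathsf{C}$. A Hopf algebra is written $X=(X,\eta_X,\mu_X,\varepsilon_X,\delta_X,\lambda_X)$; it is cocommutative if $c_{X,X}\circ\delta_X=\delta_X$. Tensor products of algebras and coalgebras carry $\mu_{A\otimes B}=(\mu_A\otimes\mu_B)\circ(A\otimes c_{B,A}\otimes B)$ and $\delta_{D\otimes E}=(D\otimes c_{D,E}\otimes E)\circ(\delta_D\otimes\delta_E)$. For a Hopf algebra $X$ and an algebra-coalgebra $A$, $(A,\varphi_A)$ is a left $X$-module algebra-coalgebra if $(A,\varphi_A)$ is a left $X$-module, $\varphi_A\circ(X\otimes\eta_A)=\varepsilon_X\otimes\eta_A$, $\varphi_A\circ(X\otimes\mu_A)=\mu_A\circ(\varphi_A\otimes\varphi_A)\circ(X\otimes c_{X,A}\otimes A)\circ(\delta_X\otimes A\otimes A)$, and $\varphi_A\colon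 X\otimes A\to A$ is a coalgebra morphism. Relative Rota-Baxter operator $(T\colon H\to B,\varphi_H)$: $H$, $B$ are Hopf algebras, $(H,\varphi_H)$ is a left $B$-module algebra-coalgebra and $T\colon H\to B$ is a coalgebra morphism with $\mu_B\circ(T\otimes T)=T\circ\mu_H\circ(H\otimes(\varphi_H\circ(T\otimes H)))\circ(\delta_H\otimes H)$. A left module over $(T\colon H\to B,\varphi_H)$ is a 6-tuple $(M,N,\phi_M,\varphi_M,\varphi_N,\gamma)$ such that: (i) $(M,\phi_M)$ is a left $H$-module, $(M,\varphi_M)$ is a left $B$-module and $\varphi_M\circ(B\otimes\phi_M)=\phi_M\circ(\varphi_H\otimes\varphi_M)\circ(B\otimes c_{B,H}\otimes M)\circ(\delta_B\otimes H\otimes M)$; (ii) $(N,\varphi_N)$ is a left $B$-module; (iii) $\gamma\colon M\to N$ is a morphism in $\mathsf{C}$ with $\varphi_N\circ(T\otimes\gamma)=\gamma\circ\phi_M\circ(H\otimes(\varphi_M\circ(T\otimes M)))\circ(\delta_H\otimes M)$. A morphism $(M,N,\phi_M,\varphi_M,\varphi_N,\gamma)\to(P,Q,\phi_P,\varphi_P,\varphi_Q,\theta)$ is a pair $(r,s)$ with $r\colon M\to P$ a morphism of left $H$-modules (for $\phi_M,\phi_P$) and of left $B$-modules (for $\varphi_M,\varphi_P$), $s\colon N\to Q$ a morphism of left $B$-modules, and $s\circ\gamma=\theta\circ r$. These form the category ${}_{(T,\varphi_H)}\mathsf{Mod}$. The category ${}_{(T,\varphi_H)}\mathsf{Mod}^{\mathsf{iso}}$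 is its full subcategory of objects $(M,N,\phi_M,\varphi_M,\varphi_N,\gamma)$ such that $\gamma\colon M\to N$ is an isomorphism in $\mathsf{C}$. Hopf brace $\mathbb{H}=(H_1,H_2)$: Hopf algebras $H_1=(H,\eta_H,\mu_H^1,\varepsilon_H,\delta_H,\lambda_H^1)$, $H_2=(H,\eta_H,\mu_H^2,\varepsilon_H,\delta_H,\lambda_H^2)$ on the same coalgebra with $\mu_H^2\circ(H\otimes\mu_H^1)=\mu_H^1\circ(\mu_H^2\otimes\Gamma_{H_1})\circ(H\otimes c_{H,H}\otimes H)\circ(\delta_H\otimes H\otimes H)$, where $\Gamma_{H_1}=\mu_H^1\circ(\lambda_H^1\otimes\mu_H^2)\circ(\delta_H\otimes H)$. A left module over a Hopf brace $\mathbb{H}$ is a triple $(M,\psi_M^1,\psi_M^2)$ with $(M,\psi_M^1)$ a left $H_1$-module, $(M,\psi_M^2)$ a left $H_2$-module and $\psi_M^2\circ(H\otimes\psi_M^1)=\psi_M^1\circ(\mu_H^2\otimes\Gamma_M)\circ(H\otimes c_{H,H}\otimes M)\circ(\delta_H\otimes H\otimes M)$, where $\Gamma_M=\psi_M^1\circ(\lambda_H^1\otimes\psi_M^2)\circ(\delta_H\otimes M)$. Morphisms are morphisms in $\mathsf{C}$ that are both left $H_1$-module and left $H_2$-module morphisms. This is the category ${}_{\mathbb{H}}\mathsf{Mod}$. Hopf brace associated to $(T\colon H\to B,\varphi_H)$ with $H$ cocommutative: $\overline{\mathbb{H}}=(H,\overline{H})$, where the first structure is $H$ itself and $\overline{H}=(H,\eta_H,\overline{\mu}_H,\varepsilon_H,\delta_H,\overline{\lambda}_H)$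 with $\overline{\mu}_H=\mu_H\circ(H\otimes(\varphi_H\circ(T\otimes H)))\circ(\delta_H\otimes H)$, $\overline{\lambda}_H=\varphi_H\circ((\lambda_B\circ T)\otimes\lambda_H)\circ\delta_H$. *)

theory Defs
  imports Main
begin

section \<open>Categories, functors and equivalences\<close>

record ('o, 'm) cat_data =
  Ob :: "'o set"
  Ar :: "'m set"
  Dom :: "'m \<Rightarrow> 'o"
  Cod :: "'m \<Rightarrow> 'o"
  Id :: "'o \<Rightarrow> 'm"  ("\<one>\<index>")
  Comp :: "'m \<Rightarrow> 'm \<Rightarrow> 'm"  (infixr "\<cdot>\<index>" 55)

definition homset :: "('o, 'm, 'z) cat_data_scheme \<Rightarrow> 'o \<Rightarrow> 'o \<Rightarrow> 'm set"  ("hom\<index>")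
  where "homset C A B = {f \<in> Ar C. Dom C f = A \<and> Cod C f = B}"

locale category =
  fixes C :: "('o, 'm, 'z) cat_data_scheme"  (structure)
  assumes dom_ob: "f \<in> Ar C \<Longrightarrow> Dom C f \<in> Ob C"
    and cod_ob: "f \<in> Ar C \<Longrightarrow> Cod C f \<in> Ob C"
    and id_hom: "A \<in> Ob C \<Longrightarrow> \<one> A \<in> hom A A"
    and comp_hom: "f \<in> hom A B \<Longrightarrow> g \<in> hom B D \<Longrightarrow> g \<cdot> f \<in> hom A D"
    and comp_assoc:
      "f \<in> hom A B \<Longrightarrow> g \<in> hom B D \<Longrightarrow> h \<in> hom D E \<Longrightarrow> (h \<cdot> g) \<cdot> f = h \<cdot> (g \<cdot> f)"
    and comp_id_left: "f \<in> hom A B \<Longrightarrow> \<one> B \<cdot> f = f"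
    and comp_id_right: "f \<in> hom A B \<Longrightarrow> f \<cdot> \<one> A = f"

definition is_iso :: "('o, 'm, 'z) cat_data_scheme \<Rightarrow> 'm \<Rightarrow> bool"
  where "is_iso C f \<longleftrightarrow> f \<in> Ar C \<and>
    (\<exists>g \<in> hom\<^bsub>C\<^esub> (Cod C f) (Dom C f).
       g \<cdot>\<^bsub>C\<^esub> f = \<one>\<^bsub>C\<^esub> (Dom C f) \<and> f \<cdot>\<^bsub>C\<^esub> g = \<one>\<^bsub>C\<^esub> (Cod C f))"

definition full_subcategory ::
    "('o, 'm) cat_data \<Rightarrow> ('o \<Rightarrow> bool) \<Rightarrow> ('o, 'm) cat_data"
  where "full_subcategory C P =
    C\<lparr>Ob := {A \<in> Ob C. P A}, Ar := {f \<in> Ar C. P (Dom C f) \<and> P (Cod C f)}\<rparr>"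

text \<open>A functor is given by its object map and its arrow map.\<close>

definition is_functor ::
    "('o, 'm, 'y) cat_data_scheme \<Rightarrow> ('p, 'n, 'z) cat_data_scheme \<Rightarrow>
     ('o \<Rightarrow> 'p) \<Rightarrow> ('m \<Rightarrow> 'n) \<Rightarrow> bool"
  where "is_functor C D Fo Fa \<longleftrightarrow>
    (\<forall>A \<in> Ob C. Fo A \<in> Ob D) \<and>
    (\<forall>A B. \<forall>f \<in> hom\<^bsub>C\<^esub> A B. Fa f \<in> hom\<^bsub>D\<^esub> (Fo A) (Fo B)) \<and>
    (\<forall>A \<in> Ob C. Fa (\<one>\<^bsub>C\<^esub> A) = \<one>\<^bsub>D\<^esub> (Fo A)) \<and>
    (\<forall>A B E. \<forall>f \<in> hom\<^bsub>C\<^esub> A B. \<forall>g \<in> hom\<^bsub>C\<^esub> B E. Fa (g \<cdot>\<^bsub>C\<^esub> f) = Fa g \<cdot>\<^bsub>D\<^esub> Fa f)"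

definition is_natural_iso ::
    "('o, 'm, 'y) cat_data_scheme \<Rightarrow> ('p, 'n, 'z) cat_data_scheme \<Rightarrow>
     ('o \<Rightarrow> 'p) \<Rightarrow> ('m \<Rightarrow> 'n) \<Rightarrow> ('o \<Rightarrow> 'p) \<Rightarrow> ('m \<Rightarrow> 'n) \<Rightarrow> ('o \<Rightarrow> 'n) \<Rightarrow> bool"
  where "is_natural_iso C D Fo Fa Go Ga t \<longleftrightarrow>
    (\<forall>A \<in> Ob C. t A \<in> hom\<^bsub>D\<^esub> (Fo A) (Go A) \<and> is_iso D (t A)) \<and>
    (\<forall>A B. \<forall>f \<in> hom\<^bsub>C\<^esub> A B. t B \<cdot>\<^bsub>D\<^esub> Fa f = Ga f \<cdot>\<^bsub>D\<^esub> t A)"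

definition equivalent_categories ::
    "('o, 'm, 'y) cat_data_scheme \<Rightarrow> ('p, 'n, 'z) cat_data_scheme \<Rightarrow> bool"
  where "equivalent_categories C D \<longleftrightarrow> category C \<and> category D \<and>
    (\<exists>Fo Fa Go Ga s t.
       is_functor C D Fo Fa \<and> is_functor D C Go Ga \<and>
       is_natural_iso C C (Go \<circ> Fo) (Ga \<circ> Fa) id id s \<and>
       is_natural_iso D D (Fo \<circ> Go) (Fa \<circ> Ga) id id t)"

section \<open>Strict braided monoidal categories\<close>

record ('o, 'm) braided_data = "('o, 'm) cat_data" +
  tensor_ob :: "'o \<Rightarrow> 'o \<Rightarrow> 'o"  (infixr "\<otimes>\<^sub>o\<index>" 65)
  tensor :: "'m \<Rightarrow> 'm \<Rightarrow> 'm"  (infixr "\<otimes>\<index>" 65)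
  unit_ob :: 'o  ("\<K>\<index>")
  braid :: "'o \<Rightarrow> 'o \<Rightarrow> 'm"  ("\<c>\<index>")

locale braided_cat = category C for C :: "('o, 'm) braided_data"  (structure) +
  assumes unit_ob: "\<K> \<in> Ob C"
    and tensor_ob: "A \<in> Ob C \<Longrightarrow> B \<in> Ob C \<Longrightarrow> A \<otimes>\<^sub>o B \<in> Ob C"
    and tensor_hom:
      "f \<in> hom A B \<Longrightarrow> g \<in> hom A' B' \<Longrightarrow> f \<otimes> g \<in> hom (A \<otimes>\<^sub>o A') (B \<otimes>\<^sub>o B')"
    and tensor_id: "A \<in> Ob C \<Longrightarrow> B \<in> Ob C \<Longrightarrow> \<one> A \<otimes> \<one> B = \<one> (A \<otimes>\<^sub>o B)"
    and tensor_comp: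
      "f \<in> hom A B \<Longrightarrow> g \<in> hom B D \<Longrightarrow> f' \<in> hom A' B' \<Longrightarrow> g' \<in> hom B' D' \<Longrightarrow>
       (g \<cdot> f) \<otimes> (g' \<cdot> f') = (g \<otimes> g') \<cdot> (f \<otimes> f')"
    and tensor_ob_assoc:
      "A \<in> Ob C \<Longrightarrow> B \<in> Ob C \<Longrightarrow> D \<in> Ob C \<Longrightarrow> (A \<otimes>\<^sub>o B) \<otimes>\<^sub>o D = A \<otimes>\<^sub>o (B \<otimes>\<^sub>o D)"
    and tensor_ob_unit_left: "A \<in> Ob C \<Longrightarrow> \<K> \<otimes>\<^sub>o A = A"
    and tensor_ob_unit_right: "A \<in> Ob C \<Longrightarrow> A \<otimes>\<^sub>o \<K> = A"
    and tensor_assoc: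
      "f \<in> Ar C \<Longrightarrow> g \<in> Ar C \<Longrightarrow> h \<in> Ar C \<Longrightarrow> (f \<otimes> g) \<otimes> h = f \<otimes> (g \<otimes> h)"
    and tensor_unit_left: "f \<in> Ar C \<Longrightarrow> \<one> \<K> \<otimes> f = f"
    and tensor_unit_right: "f \<in> Ar C \<Longrightarrow> f \<otimes> \<one> \<K> = f"
    and braid_hom: "A \<in> Ob C \<Longrightarrow> B \<in> Ob C \<Longrightarrow> \<c> A B \<in> hom (A \<otimes>\<^sub>o B) (B \<otimes>\<^sub>o A)"
    and braid_iso: "A \<in> Ob C \<Longrightarrow> B \<in> Ob C \<Longrightarrow> is_iso C (\<c> A B)"
    and braid_natural:
      "f \<in> hom A B \<Longrightarrow> g \<in> hom A' B' \<Longrightarrow> \<c> B B' \<cdot> (f \<otimes> g) = (g \<otimes> f) \<cdot> \<c> A A'"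
    and braid_tensor_right:
      "A \<in> Ob C \<Longrightarrow> B \<in> Ob C \<Longrightarrow> D \<in> Ob C \<Longrightarrow>
       \<c> A (B \<otimes>\<^sub>o D) = (\<one> B \<otimes> \<c> A D) \<cdot> (\<c> A B \<otimes> \<one> D)"
    and braid_tensor_left:
      "A \<in> Ob C \<Longrightarrow> B \<in> Ob C \<Longrightarrow> D \<in> Ob C \<Longrightarrow>
       \<c> (A \<otimes>\<^sub>o B) D = (\<c> A D \<otimes> \<one> B) \<cdot> (\<one> A \<otimes> \<c> B D)"

section \<open>Hopf algebras and modules in a braided category\<close>

record ('o, 'm) coalg_data =
  car :: 'o
  \<epsilon> :: 'm
  \<delta> :: 'm

record ('o, 'm) algcoalg_data = "('o, 'm) coalg_data" +
  \<eta> :: 'm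
  \<mu> :: 'm

record ('o, 'm) hopf_data = "('o, 'm) algcoalg_data" +
  antipode :: 'm

context braided_cat
begin

definition is_algebra :: "('o, 'm, 'z) algcoalg_data_scheme \<Rightarrow> bool"
  where "is_algebra A \<longleftrightarrow>
    car A \<in> Ob C \<and>
    \<eta> A \<in> hom \<K> (car A) \<and>
    \<mu> A \<in> hom (car A \<otimes>\<^sub>o car A) (car A) \<and>
    \<mu> A \<cdot> (\<one> (car A) \<otimes> \<eta> A) = \<one> (car A) \<and>
    \<mu> A \<cdot> (\<eta> A \<otimes> \<one> (car A)) = \<one> (car A) \<and>
    \<mu> A \<cdot> (\<one> (car A) \<otimes> \<mu> A) = \<mu> A \<cdot> (\<mu> A \<otimes> \<one> (car A))"

definition is_coalgebra :: "('o, 'm, 'z) coalg_data_scheme \<Rightarrow> bool"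
  where "is_coalgebra D \<longleftrightarrow>
    car D \<in> Ob C \<and>
    \<epsilon> D \<in> hom (car D) \<K> \<and>
    \<delta> D \<in> hom (car D) (car D \<otimes>\<^sub>o car D) \<and>
    (\<one> (car D) \<otimes> \<epsilon> D) \<cdot> \<delta> D = \<one> (car D) \<and>
    (\<epsilon> D \<otimes> \<one> (car D)) \<cdot> \<delta> D = \<one> (car D) \<and>
    (\<one> (car D) \<otimes> \<delta> D) \<cdot> \<delta> D = (\<delta> D \<otimes> \<one> (car D)) \<cdot> \<delta> D"

definition is_cocommutative :: "('o, 'm, 'z) coalg_data_scheme \<Rightarrow> bool"
  where "is_cocommutative D \<longleftrightarrow> \<c> (car D) (car D) \<cdot> \<delta> D = \<delta> D"

definition unit_coalg :: "('o, 'm) coalg_data"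
  where "unit_coalg = \<lparr>car = \<K>, \<epsilon> = \<one> \<K>, \<delta> = \<one> \<K>\<rparr>"

definition tensor_coalg ::
    "('o, 'm, 'y) coalg_data_scheme \<Rightarrow> ('o, 'm, 'z) coalg_data_scheme \<Rightarrow> ('o, 'm) coalg_data"
  where "tensor_coalg D E =
    \<lparr>car = car D \<otimes>\<^sub>o car E,
     \<epsilon> = \<epsilon> D \<otimes> \<epsilon> E,
     \<delta> = (\<one> (car D) \<otimes> \<c> (car D) (car E) \<otimes> \<one> (car E)) \<cdot> (\<delta> D \<otimes> \<delta> E)\<rparr>"

definition coalg_morphism ::
    "('o, 'm, 'y) coalg_data_scheme \<Rightarrow> ('o, 'm, 'z) coalg_data_scheme \<Rightarrow> 'm \<Rightarrow> bool"
  where "coalg_morphism D E f \<longleftrightarrow>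
    f \<in> hom (car D) (car E) \<and>
    \<epsilon> E \<cdot> f = \<epsilon> D \<and>
    \<delta> E \<cdot> f = (f \<otimes> f) \<cdot> \<delta> D"

definition is_hopf_algebra :: "('o, 'm) hopf_data \<Rightarrow> bool"
  where "is_hopf_algebra X \<longleftrightarrow>
    is_algebra X \<and> is_coalgebra X \<and>
    coalg_morphism unit_coalg X (\<eta> X) \<and>
    coalg_morphism (tensor_coalg X X) X (\<mu> X) \<and>
    antipode X \<in> hom (car X) (car X) \<and>
    \<mu> X \<cdot> (\<one> (car X) \<otimes> antipode X) \<cdot> \<delta> X = \<eta> X \<cdot> \<epsilon> X \<and>
    \<mu> X \<cdot> (antipode X \<otimes> \<one> (car X)) \<cdot> \<delta> X = \<eta> X \<cdot> \<epsilon> X"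

definition left_module :: "('o, 'm, 'z) algcoalg_data_scheme \<Rightarrow> 'o \<Rightarrow> 'm \<Rightarrow> bool"
  where "left_module X M a \<longleftrightarrow>
    M \<in> Ob C \<and>
    a \<in> hom (car X \<otimes>\<^sub>o M) M \<and>
    a \<cdot> (\<eta> X \<otimes> \<one> M) = \<one> M \<and>
    a \<cdot> (\<one> (car X) \<otimes> a) = a \<cdot> (\<mu> X \<otimes> \<one> M)"

definition module_morphism ::
    "('o, 'm, 'z) algcoalg_data_scheme \<Rightarrow> 'o \<Rightarrow> 'm \<Rightarrow> 'o \<Rightarrow> 'm \<Rightarrow> 'm \<Rightarrow> bool"
  where "module_morphism X M a P b r \<longleftrightarrow>
    r \<in> hom M P \<and> r \<cdot> a = b \<cdot> (\<one> (car X) \<otimes> r)"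

definition module_algebra_coalgebra ::
    "('o, 'm) hopf_data \<Rightarrow> ('o, 'm, 'z) algcoalg_data_scheme \<Rightarrow> 'm \<Rightarrow> bool"
  where "module_algebra_coalgebra X A a \<longleftrightarrow>
    is_algebra A \<and> is_coalgebra A \<and>
    left_module X (car A) a \<and>
    a \<cdot> (\<one> (car X) \<otimes> \<eta> A) = \<epsilon> X \<otimes> \<eta> A \<and>
    a \<cdot> (\<one> (car X) \<otimes> \<mu> A) =
      \<mu> A \<cdot> (a \<otimes> a) \<cdot> (\<one> (car X) \<otimes> \<c> (car X) (car A) \<otimes> \<one> (car A))
          \<cdot> (\<delta> X \<otimes> \<one> (car A) \<otimes> \<one> (car A)) \<and>
    coalg_morphism (tensor_coalg X A) A a"

section \<open>Relative Rota-Baxter operators and their modules\<close>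

definition rel_rota_baxter ::
    "('o, 'm) hopf_data \<Rightarrow> ('o, 'm) hopf_data \<Rightarrow> 'm \<Rightarrow> 'm \<Rightarrow> bool"
  where "rel_rota_baxter H B T \<phi>H \<longleftrightarrow>
    is_hopf_algebra H \<and> is_hopf_algebra B \<and>
    module_algebra_coalgebra B H \<phi>H \<and>
    coalg_morphism H B T \<and>
    \<mu> B \<cdot> (T \<otimes> T) =
      T \<cdot> \<mu> H \<cdot> (\<one> (car H) \<otimes> (\<phi>H \<cdot> (T \<otimes> \<one> (car H)))) \<cdot> (\<delta> H \<otimes> \<one> (car H))"

text \<open>In a tuple \<open>(M, N, h, b, n, g)\<close> below, \<open>h\<close> is the \<open>H\<close>-action on \<open>M\<close>, and
  \<open>b\<close> and \<open>n\<close> are the \<open>B\<close>-actions on \<open>M\<close> and \<open>N\<close>.\<close>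

fun rb_module ::
    "('o, 'm) hopf_data \<Rightarrow> ('o, 'm) hopf_data \<Rightarrow> 'm \<Rightarrow> 'm \<Rightarrow>
     'o \<times> 'o \<times> 'm \<times> 'm \<times> 'm \<times> 'm \<Rightarrow> bool"
  where "rb_module H B T \<phi>H (M, N, h, b, n, g) \<longleftrightarrow>
    left_module H M h \<and>
    left_module B M b \<and>
    b \<cdot> (\<one> (car B) \<otimes> h) =
      h \<cdot> (\<phi>H \<otimes> b) \<cdot> (\<one> (car B) \<otimes> \<c> (car B) (car H) \<otimes> \<one> M)
        \<cdot> (\<delta> B \<otimes> \<one> (car H) \<otimes> \<one> M) \<and>
    left_module B N n \<and>
    g \<in> hom M N \<and>
    n \<cdot> (T \<otimes> g) = g \<cdot> h \<cdot> (\<one> (car H) \<otimes> (b \<cdot> (T \<otimes> \<one> M))) \<cdot> (\<delta> H \<otimes> \<one> M)"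

fun rb_module_morphism ::
    "('o, 'm) hopf_data \<Rightarrow> ('o, 'm) hopf_data \<Rightarrow>
     'o \<times> 'o \<times> 'm \<times> 'm \<times> 'm \<times> 'm \<Rightarrow> 'o \<times> 'o \<times> 'm \<times> 'm \<times> 'm \<times> 'm \<Rightarrow> 'm \<times> 'm \<Rightarrow> bool"
  where "rb_module_morphism H B (M, N, h, b, n, g) (P, Q, h', b', n', g') (r, s) \<longleftrightarrow>
    module_morphism H M h P h' r \<and>
    module_morphism B M b P b' r \<and>
    module_morphism B N n Q n' s \<and>
    s \<cdot> g = g' \<cdot> r"

text \<open>An arrow of the module categories carries its domain and codomain, because the
  underlying morphisms of \<open>C\<close> do not determine the actions on either side.\<close>

definition rb_mod_cat ::
    "('o, 'm) hopf_data \<Rightarrow> ('o, 'm) hopf_data \<Rightarrow> 'm \<Rightarrow> 'm \<Rightarrow>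
     ('o \<times> 'o \<times> 'm \<times> 'm \<times> 'm \<times> 'm,
      ('o \<times> 'o \<times> 'm \<times> 'm \<times> 'm \<times> 'm) \<times> ('o \<times> 'o \<times> 'm \<times> 'm \<times> 'm \<times> 'm) \<times> ('m \<times> 'm)) cat_data"
  where "rb_mod_cat H B T \<phi>H =
    \<lparr>Ob = {X. rb_module H B T \<phi>H X},
     Ar = {(X, Y, u). rb_module H B T \<phi>H X \<and> rb_module H B T \<phi>H Y \<and>
                      rb_module_morphism H B X Y u},
     Dom = (\<lambda>(X, Y, u). X),
     Cod = (\<lambda>(X, Y, u). Y),
     Id = (\<lambda>X. (X, X, case X of (M, N, _) \<Rightarrow> (\<one> M, \<one> N))),
     Comp = (\<lambda>(Y', Z, (r', s')) (X, Y, (r, s)). (X, Z, (r' \<cdot> r, s' \<cdot> s)))\<rparr>"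

definition rb_mod_iso_cat ::
    "('o, 'm) hopf_data \<Rightarrow> ('o, 'm) hopf_data \<Rightarrow> 'm \<Rightarrow> 'm \<Rightarrow>
     ('o \<times> 'o \<times> 'm \<times> 'm \<times> 'm \<times> 'm,
      ('o \<times> 'o \<times> 'm \<times> 'm \<times> 'm \<times> 'm) \<times> ('o \<times> 'o \<times> 'm \<times> 'm \<times> 'm \<times> 'm) \<times> ('m \<times> 'm)) cat_data"
  where "rb_mod_iso_cat H B T \<phi>H =
    full_subcategory (rb_mod_cat H B T \<phi>H) (\<lambda>(M, N, h, b, n, g). is_iso C g)"

section \<open>Hopf braces and their modules\<close>

definition brace_\<Gamma> :: "('o, 'm) hopf_data \<times> ('o, 'm) hopf_data \<Rightarrow> 'o \<Rightarrow> 'm \<Rightarrow> 'm \<Rightarrow> 'm"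
  where "brace_\<Gamma> \<H> M a1 a2 =
    a1 \<cdot> (antipode (fst \<H>) \<otimes> a2) \<cdot> (\<delta> (fst \<H>) \<otimes> \<one> M)"

text \<open>The morphism \<open>\<Gamma>\<close> of a Hopf brace itself is that of the regular actions
  \<open>\<mu> H1\<close> and \<open>\<mu> H2\<close>.\<close>

fun hopf_brace :: "('o, 'm) hopf_data \<times> ('o, 'm) hopf_data \<Rightarrow> bool"
  where "hopf_brace (H1, H2) \<longleftrightarrow>
    is_hopf_algebra H1 \<and> is_hopf_algebra H2 \<and>
    car H2 = car H1 \<and> \<eta> H2 = \<eta> H1 \<and> \<epsilon> H2 = \<epsilon> H1 \<and> \<delta> H2 = \<delta> H1 \<and>
    \<mu> H2 \<cdot> (\<one> (car H1) \<otimes> \<mu> H1) =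
      \<mu> H1 \<cdot> (\<mu> H2 \<otimes> brace_\<Gamma> (H1, H2) (car H1) (\<mu> H1) (\<mu> H2))
           \<cdot> (\<one> (car H1) \<otimes> \<c> (car H1) (car H1) \<otimes> \<one> (car H1))
           \<cdot> (\<delta> H1 \<otimes> \<one> (car H1) \<otimes> \<one> (car H1))"

fun brace_module ::
    "('o, 'm) hopf_data \<times> ('o, 'm) hopf_data \<Rightarrow> 'o \<times> 'm \<times> 'm \<Rightarrow> bool"
  where "brace_module (H1, H2) (M, a1, a2) \<longleftrightarrow>
    left_module H1 M a1 \<and>
    left_module H2 M a2 \<and>
    a2 \<cdot> (\<one> (car H1) \<otimes> a1) =
      a1 \<cdot> (\<mu> H2 \<otimes> brace_\<Gamma> (H1, H2) M a1 a2)
         \<cdot> (\<one> (car H1) \<otimes> \<c> (car H1) (car H1) \<otimes> \<one> M)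
         \<cdot> (\<delta> H1 \<otimes> \<one> (car H1) \<otimes> \<one> M)"

fun brace_module_morphism ::
    "('o, 'm) hopf_data \<times> ('o, 'm) hopf_data \<Rightarrow> 'o \<times> 'm \<times> 'm \<Rightarrow> 'o \<times> 'm \<times> 'm \<Rightarrow> 'm \<Rightarrow> bool"
  where "brace_module_morphism (H1, H2) (M, a1, a2) (P, b1, b2) r \<longleftrightarrow>
    module_morphism H1 M a1 P b1 r \<and> module_morphism H2 M a2 P b2 r"

definition brace_mod_cat ::
    "('o, 'm) hopf_data \<times> ('o, 'm) hopf_data \<Rightarrow>
     ('o \<times> 'm \<times> 'm, ('o \<times> 'm \<times> 'm) \<times> ('o \<times> 'm \<times> 'm) \<times> 'm) cat_data"
  where "brace_mod_cat \<H> =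
    \<lparr>Ob = {X. brace_module \<H> X},
     Ar = {(X, Y, r). brace_module \<H> X \<and> brace_module \<H> Y \<and> brace_module_morphism \<H> X Y r},
     Dom = (\<lambda>(X, Y, r). X),
     Cod = (\<lambda>(X, Y, r). Y),
     Id = (\<lambda>X. (X, X, \<one> (fst X))),
     Comp = (\<lambda>(Y', Z, r') (X, Y, r). (X, Z, r' \<cdot> r))\<rparr>"

text \<open>For a relative Rota-Baxter operator with \<open>H\<close> cocommutative, the following pair
  satisfies \<open>hopf_brace\<close>; this is a theorem, so it is not imposed in the definition.\<close>

definition associated_brace ::
    "('o, 'm) hopf_data \<Rightarrow> ('o, 'm) hopf_data \<Rightarrow> 'm \<Rightarrow> 'm \<Rightarrow>
     ('o, 'm) hopf_data \<times> ('o, 'm) hopf_data"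
  where "associated_brace H B T \<phi>H =
    (H,
     H\<lparr>\<mu> := \<mu> H \<cdot> (\<one> (car H) \<otimes> (\<phi>H \<cdot> (T \<otimes> \<one> (car H)))) \<cdot> (\<delta> H \<otimes> \<one> (car H)),
       antipode := \<phi>H \<cdot> ((antipode B \<cdot> T) \<otimes> antipode H) \<cdot> \<delta> H\<rparr>)"

end

end

theory Submission
  imports Defs
begin

text \<open>
  Let \<open>x \<circ> y = x\<^sub>1 \<phi>(T x\<^sub>2, y)\<close> be the second product on \<open>H\<close>. The isomorphism \<open>T\<close> transports the
  product of \<open>B\<close> to \<open>\<circ>\<close>, so \<open>\<circ>\<close> is a coalgebra morphism and \<open>B\<close>-modules are the same as modules over
  \<open>(H, \<circ>)\<close>. A \<open>B\<close>-action on \<open>M\<close>, pulled back along \<open>T\<close> to \<open>\<beta>\<close>, and a second brace action determine each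
  other through \<open>x \<circ> m = x\<^sub>1 \<cdot> \<beta>(x\<^sub>2, m)\<close> and \<open>\<beta>(x, m) = \<Gamma>(x, m) = \<lambda>(x\<^sub>1) \<cdot> (x\<^sub>2 \<circ> m)\<close>, and cancelling
  \<open>x\<^sub>1\<close> turns the compatibility of a brace module into that of a module over \<open>(T, \<phi>)\<close>.
  Finally, \<open>\<gamma>\<close> itself identifies \<open>(M, N, \<gamma>)\<close> with \<open>(M, M, id)\<close>, where the
  condition on \<open>\<gamma>\<close> says that the \<open>B\<close>-action on \<open>N\<close> corresponds to \<open>\<circ>\<close>.
\<close>

section \<open>Calculus in strict braided categories\<close>

text \<open>Cancelling an element has no literal counterpart for morphisms of a braided category.
  The substitute: for a coalgebra \<open>D\<close> and an algebra \<open>X\<close>, the morphisms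
  from \<open>D\<close> to \<open>X\<close> form a monoid under convolution, and for an
  \<open>X\<close>-module \<open>M\<close> this monoid acts by \<open>conv_act\<close> on the
  morphisms from D \<otimes> Y to \<open>M\<close>. A leg can be removed as soon as it has a
  convolution inverse; over \<open>H\<close>, the identity and the antipode are inverse to each
  other. The step that shapes the development is that \<Gamma> is again an action of the second
  product. There the leg to be cancelled is x \<circ> y, so the acting coalgebra is the tensor
  square of \<open>H\<close>: its coassociativity has to be pushed through the braiding, and
  \<open>\<mu> Hbar\<close> must be a coalgebra morphism so that the antipode of \<open>H\<close>
  after it is a convolution inverse. The compatibility condition of a brace module fits this setting
  because its braiding is the one in the coproduct of the tensor square.\<close>

context category
begin

lemma hom_iff: "f \<in> hom A B \<longleftrightarrow> f \<in> Ar C \<and> Dom C f = A \<and> Cod C f = B"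
  by (simp add: homset_def)

lemma id_arr [simp]:
  assumes "A \<in> Ob C"
  shows "\<one> A \<in> Ar C" "Dom C (\<one> A) = A" "Cod C (\<one> A) = A"
  using id_hom[OF assms] by (simp_all add: hom_iff)

text \<open>In the rules over \<open>hom\<close> some objects occur only in the premises. Stated
  through \<open>Ar\<close>, \<open>Dom\<close> and \<open>Cod\<close>, the typing conditions can be
  computed along a term by rewriting.\<close>

lemma comp_arr [simp]:
  assumes "f \<in> Ar C" "g \<in> Ar C" "Dom C g = Cod C f"
  shows "g \<cdot> f \<in> Ar C" "Dom C (g \<cdot> f) = Dom C f" "Cod C (g \<cdot> f) = Cod C g"
  using comp_hom[of f "Dom C f" "Cod C f" g "Cod C g"] assms by (simp_all add: hom_iff)

lemma comp_assoc_arr [simp]: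
  assumes "f \<in> Ar C" "g \<in> Ar C" "h \<in> Ar C" "Dom C g = Cod C f" "Dom C h = Cod C g"
  shows "(h \<cdot> g) \<cdot> f = h \<cdot> (g \<cdot> f)"
  using comp_assoc[of f "Dom C f" "Cod C f" g "Cod C g" h "Cod C h"] assms by (simp add: hom_iff)

lemma comp_id_arr [simp]:
  assumes "f \<in> Ar C"
  shows "Cod C f = A \<Longrightarrow> \<one> A \<cdot> f = f" "Dom C f = A \<Longrightarrow> f \<cdot> \<one> A = f"
  using assms comp_id_left comp_id_right by (auto simp: hom_iff)

text \<open>Composites are normalised to the right, so the left side of an equation for
  \<open>g \<cdot> f\<close> is no longer a subterm once something precedes \<open>f\<close>; this
  is the form that still applies there.\<close>

lemma comp_reduce:
  assumes "g \<cdot> f = h" "f \<in> Ar C" "g \<in> Ar C" "k \<in> Ar C" "Dom C g = Cod C f" "Dom C f = Cod C k"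
  shows "g \<cdot> (f \<cdot> k) = h \<cdot> k"
  using assms by (simp flip: comp_assoc_arr)

lemma ob_of_arr: "f \<in> hom A B \<Longrightarrow> A \<in> Ob C \<and> B \<in> Ob C"
  using dom_ob cod_ob by (auto simp: hom_iff)

end

section \<open>Normal forms for tensor products and the interchange law\<close>

context braided_cat
begin

lemmas ob_simps [simp] = unit_ob tensor_ob tensor_ob_assoc tensor_ob_unit_left tensor_ob_unit_right

lemma tensor_arr [simp]:
  assumes "f \<in> Ar C" "g \<in> Ar C"
  shows "f \<otimes> g \<in> Ar C" "Dom C (f \<otimes> g) = Dom C f \<otimes>\<^sub>o Dom C g"
    "Cod C (f \<otimes> g) = Cod C f \<otimes>\<^sub>o Cod C g"
  using tensor_hom[of f "Dom C f" "Cod C f" g "Dom C g" "Cod C g"] assms by (simp_all add: hom_iff)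

lemma braid_arr [simp]:
  assumes "A \<in> Ob C" "B \<in> Ob C"
  shows "\<c> A B \<in> Ar C" "Dom C (\<c> A B) = A \<otimes>\<^sub>o B" "Cod C (\<c> A B) = B \<otimes>\<^sub>o A"
  using braid_hom[OF assms] by (simp_all add: hom_iff)

lemmas tensor_simps [simp] = tensor_id tensor_assoc tensor_unit_left tensor_unit_right

text \<open>Fusing leading identities gives whiskered morphisms one normal form, however the
  whiskering was bracketed.\<close>

lemma tensor_id_id [simp]:
  "A \<in> Ob C \<Longrightarrow> B \<in> Ob C \<Longrightarrow> f \<in> Ar C \<Longrightarrow> \<one> A \<otimes> (\<one> B \<otimes> f) = \<one> (A \<otimes>\<^sub>o B) \<otimes> f"
  by (simp flip: tensor_assoc tensor_id)

lemma interchange: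
  assumes "f \<in> Ar C" "g \<in> Ar C" "f' \<in> Ar C" "g' \<in> Ar C" "Dom C g = Cod C f" "Dom C g' = Cod C f'"
  shows "(g \<otimes> g') \<cdot> (f \<otimes> f') = (g \<cdot> f) \<otimes> (g' \<cdot> f')"
  using tensor_comp[of f "Dom C f" "Cod C f" g "Cod C g" f' "Dom C f'" "Cod C f'" g' "Cod C g'"] assms
  by (simp add: hom_iff)

lemma interchange_comp:
  assumes "f \<in> Ar C" "g \<in> Ar C" "f' \<in> Ar C" "g' \<in> Ar C" "Dom C g = Cod C f" "Dom C g' = Cod C f'"
    and "h \<in> Ar C" "Cod C h = Dom C f \<otimes>\<^sub>o Dom C f'"
  shows "(g \<otimes> g') \<cdot> ((f \<otimes> f') \<cdot> h) = ((g \<cdot> f) \<otimes> (g' \<cdot> f')) \<cdot> h"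
  using assms by (simp add: interchange flip: comp_assoc_arr)

text \<open>After tensors are reassociated to the right, a factor made of two blocks is no longer a
  subterm and plain \<open>interchange\<close> can only split off the first block. The following
  variants allow one side, or both, to be split after two blocks.\<close>

lemma interchange_left:
  assumes "f \<in> Ar C" "g1 \<in> Ar C" "g2 \<in> Ar C" "f' \<in> Ar C" "g' \<in> Ar C"
    and "Dom C g1 \<otimes>\<^sub>o Dom C g2 = Cod C f" "Dom C g' = Cod C f'"
  shows "(g1 \<otimes> g2 \<otimes> g') \<cdot> (f \<otimes> f') = ((g1 \<otimes> g2) \<cdot> f) \<otimes> (g' \<cdot> f')"
  using interchange[of f "g1 \<otimes> g2" f' g'] assms by simp

lemma interchange_right:
  assumes "f1 \<in> Ar C" "f2 \<in> Ar C" "g \<in> Ar C" "f' \<in> Ar C" "g' \<in> Ar C"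
    and "Dom C g = Cod C f1 \<otimes>\<^sub>o Cod C f2" "Dom C g' = Cod C f'"
  shows "(g \<otimes> g') \<cdot> (f1 \<otimes> f2 \<otimes> f') = (g \<cdot> (f1 \<otimes> f2)) \<otimes> (g' \<cdot> f')"
  using interchange[of "f1 \<otimes> f2" g f' g'] assms by simp

lemma interchange_both:
  assumes "f1 \<in> Ar C" "f2 \<in> Ar C" "g1 \<in> Ar C" "g2 \<in> Ar C" "f' \<in> Ar C" "g' \<in> Ar C"
    and "Dom C g1 \<otimes>\<^sub>o Dom C g2 = Cod C f1 \<otimes>\<^sub>o Cod C f2" "Dom C g' = Cod C f'"
  shows "(g1 \<otimes> g2 \<otimes> g') \<cdot> (f1 \<otimes> f2 \<otimes> f') = ((g1 \<otimes> g2) \<cdot> (f1 \<otimes> f2)) \<otimes> (g' \<cdot> f')"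
  using interchange[of "f1 \<otimes> f2" "g1 \<otimes> g2" f' g'] assms by simp

text \<open>Often used with \<open>tensor_id\<close> reversed: identities on composite objects are
  then broken up until the blocks of two factors line up.\<close>

lemmas merge = interchange interchange_left interchange_right interchange_both interchange_comp

text \<open>Keeps the identity laws available when \<open>tensor_id\<close> is reversed and an
  identity on a composite object appears as a tensor of identities.\<close>

lemma comp_tensor_id [simp]:
  assumes "A \<in> Ob C" "B \<in> Ob C" "f \<in> Ar C"
  shows "Cod C f = A \<otimes>\<^sub>o B \<Longrightarrow> (\<one> A \<otimes> \<one> B) \<cdot> f = f"
    "Dom C f = A \<otimes>\<^sub>o B \<Longrightarrow> f \<cdot> (\<one> A \<otimes> \<one> B) = f"
  using assms by simp_all

lemma whisker_right:
  assumes "f \<in> Ar C" "g \<in> Ar C" "Dom C g = Cod C f" "Y \<in> Ob C"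
  shows "(g \<cdot> f) \<otimes> \<one> Y = (g \<otimes> \<one> Y) \<cdot> (f \<otimes> \<one> Y)"
  using assms by (simp add: interchange)

section \<open>Convolution and actions\<close>

text \<open>In Sweedler notation \<open>conv_act D a Y f \<Theta>\<close> sends \<open>x \<otimes> y\<close> to \<open>f x\<^sub>1 \<cdot> \<Theta> (x\<^sub>2, y)\<close>, where
  \<open>\<cdot>\<close> is the action \<open>a\<close>; likewise \<open>cross_act D a Z M \<psi> \<beta>\<close> below sends \<open>x \<otimes> z \<otimes> m\<close> to
  \<open>\<psi> (x\<^sub>1, z) \<cdot> \<beta> (x\<^sub>2, m)\<close>.\<close>

definition conv_act :: "('o, 'm, 'z) coalg_data_scheme \<Rightarrow> 'm \<Rightarrow> 'o \<Rightarrow> 'm \<Rightarrow> 'm \<Rightarrow> 'm"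
  where "conv_act D a Y f \<Theta> = a \<cdot> (f \<otimes> \<Theta>) \<cdot> (\<delta> D \<otimes> \<one> Y)"

text \<open>The typing facts come first so that they alone can be given to the simplifier; the
  axioms behind them are applied by hand. \<open>algebraD\<close> and \<open>moduleD\<close> are
  ordered in the same way.\<close>

lemma coalgebraD:
  assumes "is_coalgebra D"
  shows "car D \<in> Ob C" "\<epsilon> D \<in> Ar C" "Dom C (\<epsilon> D) = car D" "Cod C (\<epsilon> D) = \<K>"
    "\<delta> D \<in> Ar C" "Dom C (\<delta> D) = car D" "Cod C (\<delta> D) = car D \<otimes>\<^sub>o car D"
    "(\<one> (car D) \<otimes> \<epsilon> D) \<cdot> \<delta> D = \<one> (car D)"
    "(\<epsilon> D \<otimes> \<one> (car D)) \<cdot> \<delta> D = \<one> (car D)"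
    "(\<one> (car D) \<otimes> \<delta> D) \<cdot> \<delta> D = (\<delta> D \<otimes> \<one> (car D)) \<cdot> \<delta> D"
  using assms by (auto simp: is_coalgebra_def hom_iff)

lemma algebraD:
  assumes "is_algebra A"
  shows "car A \<in> Ob C" "\<eta> A \<in> Ar C" "Dom C (\<eta> A) = \<K>" "Cod C (\<eta> A) = car A"
    "\<mu> A \<in> Ar C" "Dom C (\<mu> A) = car A \<otimes>\<^sub>o car A" "Cod C (\<mu> A) = car A"
    "\<mu> A \<cdot> (\<one> (car A) \<otimes> \<eta> A) = \<one> (car A)"
    "\<mu> A \<cdot> (\<eta> A \<otimes> \<one> (car A)) = \<one> (car A)"
    "\<mu> A \<cdot> (\<one> (car A) \<otimes> \<mu> A) = \<mu> A \<cdot> (\<mu> A \<otimes> \<one> (car A))"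
  using assms by (auto simp: is_algebra_def hom_iff)

lemma moduleD:
  assumes "left_module X M a"
  shows "M \<in> Ob C" "a \<in> Ar C" "Dom C a = car X \<otimes>\<^sub>o M" "Cod C a = M"
    "a \<cdot> (\<eta> X \<otimes> \<one> M) = \<one> M"
    "a \<cdot> (\<one> (car X) \<otimes> a) = a \<cdot> (\<mu> X \<otimes> \<one> M)"
  using assms by (auto simp: left_module_def hom_iff)

lemma coalg_morphismD:
  assumes "coalg_morphism D E f"
  shows "f \<in> Ar C" "Dom C f = car D" "Cod C f = car E"
    "\<epsilon> E \<cdot> f = \<epsilon> D" "\<delta> E \<cdot> f = (f \<otimes> f) \<cdot> \<delta> D"
  using assms by (auto simp: coalg_morphism_def hom_iff)

section \<open>The convolution monoid acting through a module\<close>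

lemma conv_act_arr [simp]:
  assumes "is_coalgebra D" "left_module X M a" "Y \<in> Ob C"
    and "f \<in> Ar C" "Dom C f = car D" "Cod C f = car X"
    and "\<Theta> \<in> Ar C" "Dom C \<Theta> = car D \<otimes>\<^sub>o Y" "Cod C \<Theta> = M"
  shows "conv_act D a Y f \<Theta> \<in> Ar C" "Dom C (conv_act D a Y f \<Theta>) = car D \<otimes>\<^sub>o Y"
    "Cod C (conv_act D a Y f \<Theta>) = M"
  using assms coalgebraD[OF assms(1)] moduleD[OF assms(2)] by (simp_all add: conv_act_def)

text \<open>Associativity of the module and coassociativity of \<open>D\<close> regroup f(x1)
  \<cdot> (g(x2) \<cdot> \<Theta>(x3, y)) as (f(x1) g(x2)) \<cdot> \<Theta>(x3, y), where f(x1)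
  g(x2) is the convolution product.\<close>

lemma conv_act_conv_act:
  assumes D: "is_coalgebra D" and X: "is_algebra X" and a: "left_module X M a" and [simp]: "Y \<in> Ob C"
    and [simp]: "f \<in> Ar C" "Dom C f = car D" "Cod C f = car X"
    and [simp]: "g \<in> Ar C" "Dom C g = car D" "Cod C g = car X"
    and [simp]: "\<Theta> \<in> Ar C" "Dom C \<Theta> = car D \<otimes>\<^sub>o Y" "Cod C \<Theta> = M"
  shows "conv_act D a Y f (conv_act D a Y g \<Theta>) = conv_act D a Y (\<mu> X \<cdot> (f \<otimes> g) \<cdot> \<delta> D) \<Theta>"
proof -
  note [simp] = coalgebraD(1-7)[OF D] moduleD(1-4)[OF a] algebraD(1-7)[OF X]
  have "conv_act D a Y f (conv_act D a Y g \<Theta>) =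
    a \<cdot> ((\<one> (car X) \<otimes> a) \<cdot> (f \<otimes> g \<otimes> \<Theta>) \<cdot> (\<one> (car D) \<otimes> \<delta> D \<otimes> \<one> Y)) \<cdot> (\<delta> D \<otimes> \<one> Y)"
    by (simp add: conv_act_def interchange interchange_comp)
  also have "\<dots> = (a \<cdot> (\<one> (car X) \<otimes> a)) \<cdot> (f \<otimes> g \<otimes> \<Theta>) \<cdot> (((\<one> (car D) \<otimes> \<delta> D) \<cdot> \<delta> D) \<otimes> \<one> Y)"
    by (simp add: whisker_right)
  also have "\<dots> = a \<cdot> ((\<mu> X \<otimes> \<one> M) \<cdot> ((f \<otimes> g) \<otimes> \<Theta>) \<cdot> (\<delta> D \<otimes> \<one> (car D \<otimes>\<^sub>o Y))) \<cdot> (\<delta> D \<otimes> \<one> Y)"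
    unfolding moduleD(6)[OF a] coalgebraD(10)[OF D] by (simp add: whisker_right)
  also have "(\<mu> X \<otimes> \<one> M) \<cdot> ((f \<otimes> g) \<otimes> \<Theta>) \<cdot> (\<delta> D \<otimes> \<one> (car D \<otimes>\<^sub>o Y)) = (\<mu> X \<cdot> (f \<otimes> g) \<cdot> \<delta> D) \<otimes> \<Theta>"
    by (simp add: interchange interchange_comp del: tensor_assoc)
  finally show ?thesis
    by (simp add: conv_act_def)
qed

text \<open>\<open>\<eta> X \<cdot> \<epsilon> D\<close> is the unit of convolution; the unit law of
  the module and the counit law of \<open>D\<close> remove it.\<close>

lemma conv_act_unit:
  assumes D: "is_coalgebra D" and X: "is_algebra X" and a: "left_module X M a" and [simp]: "Y \<in> Ob C"
    and [simp]: "\<Theta> \<in> Ar C" "Dom C \<Theta> = car D \<otimes>\<^sub>o Y" "Cod C \<Theta> = M"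
  shows "conv_act D a Y (\<eta> X \<cdot> \<epsilon> D) \<Theta> = \<Theta>"
proof -
  note [simp] = coalgebraD(1-7)[OF D] moduleD(1-4)[OF a] algebraD(1-7)[OF X]
  have "conv_act D a Y (\<eta> X \<cdot> \<epsilon> D) \<Theta> =
    a \<cdot> ((\<eta> X \<otimes> \<one> M) \<cdot> (\<one> \<K> \<otimes> \<Theta>) \<cdot> (\<epsilon> D \<otimes> \<one> (car D \<otimes>\<^sub>o Y))) \<cdot> (\<delta> D \<otimes> \<one> Y)"
    by (simp add: conv_act_def interchange interchange_comp del: tensor_unit_left tensor_unit_right)
  also have "\<dots> = (a \<cdot> (\<eta> X \<otimes> \<one> M)) \<cdot> \<Theta> \<cdot> (((\<epsilon> D \<otimes> \<one> (car D)) \<cdot> \<delta> D) \<otimes> \<one> Y)"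
    by (simp add: whisker_right)
  also have "\<dots> = \<Theta>"
    unfolding moduleD(5)[OF a] coalgebraD(9)[OF D] by simp
  finally show ?thesis .
qed

text \<open>Splitting k(x) is the same as applying \<open>k\<close> to both halves of x, which is
  the only property of \<open>k\<close> that enters.\<close>

lemma conv_act_comp:
  assumes k: "coalg_morphism D E k" and D: "is_coalgebra D" and E: "is_coalgebra E"
    and a: "left_module X M a" and [simp]: "Y \<in> Ob C"
    and [simp]: "f \<in> Ar C" "Dom C f = car E" "Cod C f = car X"
    and [simp]: "\<Theta> \<in> Ar C" "Dom C \<Theta> = car E \<otimes>\<^sub>o Y" "Cod C \<Theta> = M"
  shows "conv_act E a Y f \<Theta> \<cdot> (k \<otimes> \<one> Y) = conv_act D a Y (f \<cdot> k) (\<Theta> \<cdot> (k \<otimes> \<one> Y))"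
proof -
  note [simp] = coalgebraD(1-7)[OF D] coalgebraD(1-7)[OF E] moduleD(1-4)[OF a] coalg_morphismD(1-3)[OF k]
  have "conv_act E a Y f \<Theta> \<cdot> (k \<otimes> \<one> Y) = a \<cdot> (f \<otimes> \<Theta>) \<cdot> ((\<delta> E \<cdot> k) \<otimes> \<one> Y)"
    by (simp add: conv_act_def whisker_right)
  also have "\<dots> = a \<cdot> ((f \<otimes> \<Theta>) \<cdot> (k \<otimes> k \<otimes> \<one> Y)) \<cdot> (\<delta> D \<otimes> \<one> Y)"
    unfolding coalg_morphismD(5)[OF k] by (simp add: whisker_right)
  also have "\<dots> = conv_act D a Y (f \<cdot> k) (\<Theta> \<cdot> (k \<otimes> \<one> Y))"
    by (simp add: conv_act_def interchange)
  finally show ?thesis .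
qed

section \<open>Braiding with the unit object, and the tensor product of two coalgebras\<close>

lemma iso_cancel:
  assumes "is_iso C f" "g \<in> Ar C" "h \<in> Ar C" "Cod C g = Dom C f" "Cod C h = Dom C f" "f \<cdot> g = f \<cdot> h"
  shows "g = h"
proof -
  obtain i where [simp]: "f \<in> Ar C" "i \<in> Ar C" "Dom C i = Cod C f" "Cod C i = Dom C f"
    and i: "i \<cdot> f = \<one> (Dom C f)"
    using assms(1) by (auto simp: is_iso_def hom_iff)
  have "(i \<cdot> f) \<cdot> g = (i \<cdot> f) \<cdot> h"
    using assms by simp
  then show ?thesis
    using assms by (simp add: i)
qed

text \<open>The braiding axiom for a tensor product in the first variable, at two copies of
  \<open>\<K>\<close>, makes \<open>\<c> \<K> A\<close> idempotent, and an invertible idempotent is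
  an identity.\<close>

lemma braid_unit_left [simp]:
  assumes "A \<in> Ob C"
  shows "\<c> \<K> A = \<one> A"
proof (rule iso_cancel[OF braid_iso[OF unit_ob assms]])
  show "\<c> \<K> A \<cdot> \<c> \<K> A = \<c> \<K> A \<cdot> \<one> A"
    using braid_tensor_left[OF unit_ob unit_ob assms, symmetric] assms by simp
qed (use assms in simp_all)

lemma braid_unit_right [simp]:
  assumes "A \<in> Ob C"
  shows "\<c> A \<K> = \<one> A"
proof (rule iso_cancel[OF braid_iso[OF assms unit_ob]])
  show "\<c> A \<K> \<cdot> \<c> A \<K> = \<c> A \<K> \<cdot> \<one> A"
    using braid_tensor_right[OF assms unit_ob unit_ob, symmetric] assms by simp
qed (use assms in simp_all)

lemma braid_natural_left:
  assumes "f \<in> Ar C" "A \<in> Ob C" "Dom C f = B" "Cod C f = D"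
  shows "\<c> D A \<cdot> (f \<otimes> \<one> A) = (\<one> A \<otimes> f) \<cdot> \<c> B A"
  using braid_natural[of f B D "\<one> A" A A] assms by (simp add: hom_iff)

lemma braid_natural_right:
  assumes "f \<in> Ar C" "A \<in> Ob C" "Dom C f = B" "Cod C f = D"
  shows "\<c> A D \<cdot> (\<one> A \<otimes> f) = (f \<otimes> \<one> A) \<cdot> \<c> A B"
  using braid_natural[of "\<one> A" A A f B D] assms by (simp add: hom_iff)

text \<open>By naturality the counit of \<open>D\<close> slides through the crossing and leaves a
  braiding with \<open>\<K>\<close>, which is an identity; the counit laws of \<open>D\<close> and
  \<open>E\<close> then apply separately.\<close>

lemma tensor_coalg_counit_right:
  assumes D: "is_coalgebra D" and E: "is_coalgebra E"
  shows "(\<one> (car D \<otimes>\<^sub>o car E) \<otimes> \<epsilon> D \<otimes> \<epsilon> E) \<cdot> (\<one> (car D) \<otimes> \<c> (car D) (car E) \<otimes> \<one> (car E))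
     \<cdot> (\<delta> D \<otimes> \<delta> E) = \<one> (car D \<otimes>\<^sub>o car E)"
proof -
  note [simp] = coalgebraD(1-7)[OF D] coalgebraD(1-7)[OF E]
  have "(\<one> (car D \<otimes>\<^sub>o car E) \<otimes> \<epsilon> D \<otimes> \<epsilon> E) \<cdot> (\<one> (car D) \<otimes> \<c> (car D) (car E) \<otimes> \<one> (car E)) =
    \<one> (car D) \<otimes> ((\<one> (car E) \<otimes> \<epsilon> D) \<cdot> \<c> (car D) (car E)) \<otimes> \<epsilon> E"
    by (simp add: merge del: tensor_id tensor_id_id flip: tensor_id)
  also have "\<dots> = \<one> (car D) \<otimes> (\<epsilon> D \<otimes> \<one> (car E)) \<otimes> \<epsilon> E"
    using braid_natural_left[of "\<epsilon> D" "car E" "car D" \<K>] by simp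
  finally have *: "(\<one> (car D \<otimes>\<^sub>o car E) \<otimes> \<epsilon> D \<otimes> \<epsilon> E) \<cdot> (\<one> (car D) \<otimes> \<c> (car D) (car E) \<otimes> \<one> (car E)) =
    (\<one> (car D) \<otimes> \<epsilon> D) \<otimes> (\<one> (car E) \<otimes> \<epsilon> E)" by simp
  have "((\<one> (car D \<otimes>\<^sub>o car E) \<otimes> \<epsilon> D \<otimes> \<epsilon> E) \<cdot> (\<one> (car D) \<otimes> \<c> (car D) (car E) \<otimes> \<one> (car E)))
     \<cdot> (\<delta> D \<otimes> \<delta> E) = \<one> (car D \<otimes>\<^sub>o car E)"
    unfolding * by (simp add: interchange coalgebraD(8)[OF D] coalgebraD(8)[OF E] del: tensor_assoc)
  then show ?thesis by simp
qed

lemma tensor_coalg_counit_left: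
  assumes D: "is_coalgebra D" and E: "is_coalgebra E"
  shows "((\<epsilon> D \<otimes> \<epsilon> E) \<otimes> \<one> (car D \<otimes>\<^sub>o car E)) \<cdot> (\<one> (car D) \<otimes> \<c> (car D) (car E) \<otimes> \<one> (car E))
     \<cdot> (\<delta> D \<otimes> \<delta> E) = \<one> (car D \<otimes>\<^sub>o car E)"
proof -
  note [simp] = coalgebraD(1-7)[OF D] coalgebraD(1-7)[OF E]
  have "((\<epsilon> D \<otimes> \<epsilon> E) \<otimes> \<one> (car D \<otimes>\<^sub>o car E)) \<cdot> (\<one> (car D) \<otimes> \<c> (car D) (car E) \<otimes> \<one> (car E)) =
    \<epsilon> D \<otimes> ((\<epsilon> E \<otimes> \<one> (car D)) \<cdot> \<c> (car D) (car E)) \<otimes> \<one> (car E)"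
    by (simp add: merge del: tensor_id tensor_id_id flip: tensor_id)
  also have "\<dots> = \<epsilon> D \<otimes> (\<one> (car D) \<otimes> \<epsilon> E) \<otimes> \<one> (car E)"
    using braid_natural_right[of "\<epsilon> E" "car D" "car E" \<K>] by simp
  finally have *: "((\<epsilon> D \<otimes> \<epsilon> E) \<otimes> \<one> (car D \<otimes>\<^sub>o car E)) \<cdot> (\<one> (car D) \<otimes> \<c> (car D) (car E) \<otimes> \<one> (car E)) =
    (\<epsilon> D \<otimes> \<one> (car D)) \<otimes> (\<epsilon> E \<otimes> \<one> (car E))" by simp
  have "(((\<epsilon> D \<otimes> \<epsilon> E) \<otimes> \<one> (car D \<otimes>\<^sub>o car E)) \<cdot> (\<one> (car D) \<otimes> \<c> (car D) (car E) \<otimes> \<one> (car E)))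
     \<cdot> (\<delta> D \<otimes> \<delta> E) = \<one> (car D \<otimes>\<^sub>o car E)"
    unfolding * by (simp add: interchange coalgebraD(9)[OF D] coalgebraD(9)[OF E] del: tensor_assoc)
  then show ?thesis by simp
qed

text \<open>Both sides are brought to the threefold coproducts of \<open>D\<close> and
  \<open>E\<close> followed by three crossings that sort d d d e e e into d e d e d e. The two
  sorting orders differ only in crossings on disjoint strands.\<close>

lemma tensor_coalg_coassoc:
  assumes D: "is_coalgebra D" and E: "is_coalgebra E"
  defines "d \<equiv> car D" and "e \<equiv> car E"
  defines "\<Delta> \<equiv> (\<one> d \<otimes> \<c> d e \<otimes> \<one> e) \<cdot> (\<delta> D \<otimes> \<delta> E)"
  shows "(\<one> (d \<otimes>\<^sub>o e) \<otimes> \<Delta>) \<cdot> \<Delta> = (\<Delta> \<otimes> \<one> (d \<otimes>\<^sub>o e)) \<cdot> \<Delta>"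
proof -
  note [simp] = coalgebraD(1-7)[OF D, folded d_def] coalgebraD(1-7)[OF E, folded e_def]
  let ?\<delta>\<^sub>3 = "((\<one> d \<otimes> \<delta> D) \<cdot> \<delta> D) \<otimes> ((\<one> e \<otimes> \<delta> E) \<cdot> \<delta> E)"
  \<comment> \<open>Sliding a coproduct through a crossing doubles one strand, so naturality and the
    braiding axiom turn one crossing into two; \<open>nat2\<close> is the mirror image.\<close>
  have nat1: "(\<one> e \<otimes> \<delta> D) \<cdot> \<c> d e = (\<c> d e \<otimes> \<one> d) \<cdot> (\<one> d \<otimes> \<c> d e) \<cdot> (\<delta> D \<otimes> \<one> e)"
    using braid_natural_left[of "\<delta> D" e d "d \<otimes>\<^sub>o d"] by (simp add: braid_tensor_left)
  have nat2: "(\<delta> E \<otimes> \<one> d) \<cdot> \<c> d e = (\<one> e \<otimes> \<c> d e) \<cdot> (\<c> d e \<otimes> \<one> e) \<cdot> (\<one> d \<otimes> \<delta> E)"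
    using braid_natural_right[of "\<delta> E" d e "e \<otimes>\<^sub>o e"] by (simp add: braid_tensor_right)
  have whisk: "\<one> (d \<otimes>\<^sub>o e) \<otimes> \<Delta> =
    (\<one> (d \<otimes>\<^sub>o e \<otimes>\<^sub>o d) \<otimes> \<c> d e \<otimes> \<one> e) \<cdot> (\<one> (d \<otimes>\<^sub>o e) \<otimes> \<delta> D \<otimes> \<delta> E)"
    by (simp add: \<Delta>_def merge del: tensor_id tensor_id_id flip: tensor_id)
  have slide: "(\<one> (d \<otimes>\<^sub>o e) \<otimes> \<delta> D \<otimes> \<delta> E) \<cdot> (\<one> d \<otimes> \<c> d e \<otimes> \<one> e) =
    \<one> d \<otimes> ((\<one> e \<otimes> \<delta> D) \<cdot> \<c> d e) \<otimes> \<delta> E"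
    by (simp add: merge del: tensor_id tensor_id_id flip: tensor_id)
  have whisk': "\<Delta> \<otimes> \<one> (d \<otimes>\<^sub>o e) =
    (\<one> d \<otimes> \<c> d e \<otimes> \<one> (e \<otimes>\<^sub>o d \<otimes>\<^sub>o e)) \<cdot> (\<delta> D \<otimes> \<delta> E \<otimes> \<one> (d \<otimes>\<^sub>o e))"
    by (simp add: \<Delta>_def whisker_right)
  have slide': "(\<delta> D \<otimes> \<delta> E \<otimes> \<one> (d \<otimes>\<^sub>o e)) \<cdot> (\<one> d \<otimes> \<c> d e \<otimes> \<one> e) =
    \<delta> D \<otimes> ((\<delta> E \<otimes> \<one> d) \<cdot> \<c> d e) \<otimes> \<one> e"
    by (simp add: merge del: tensor_id tensor_id_id flip: tensor_id)
  have split: "\<one> d \<otimes> ((\<c> d e \<otimes> \<one> d) \<cdot> (\<one> d \<otimes> \<c> d e) \<cdot> (\<delta> D \<otimes> \<one> e)) \<otimes> \<delta> E =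
    (\<one> d \<otimes> \<c> d e \<otimes> \<one> (d \<otimes>\<^sub>o e \<otimes>\<^sub>o e)) \<cdot> (\<one> (d \<otimes>\<^sub>o d) \<otimes> \<c> d e \<otimes> \<one> (e \<otimes>\<^sub>o e))
      \<cdot> ((\<one> d \<otimes> \<delta> D) \<otimes> (\<one> e \<otimes> \<delta> E))"
    by (simp add: merge del: tensor_id tensor_id_id flip: tensor_id)
  have split': "\<delta> D \<otimes> ((\<one> e \<otimes> \<c> d e) \<cdot> (\<c> d e \<otimes> \<one> e) \<cdot> (\<one> d \<otimes> \<delta> E)) \<otimes> \<one> e =
    (\<one> (d \<otimes>\<^sub>o d \<otimes>\<^sub>o e) \<otimes> \<c> d e \<otimes> \<one> e) \<cdot> (\<one> (d \<otimes>\<^sub>o d) \<otimes> \<c> d e \<otimes> \<one> (e \<otimes>\<^sub>o e))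
      \<cdot> ((\<delta> D \<otimes> \<one> d) \<otimes> (\<delta> E \<otimes> \<one> e))"
    by (simp add: merge del: tensor_id tensor_id_id flip: tensor_id)
  have "(\<one> (d \<otimes>\<^sub>o e) \<otimes> \<Delta>) \<cdot> \<Delta> =
    (\<one> (d \<otimes>\<^sub>o e \<otimes>\<^sub>o d) \<otimes> \<c> d e \<otimes> \<one> e) \<cdot> (\<one> d \<otimes> ((\<one> e \<otimes> \<delta> D) \<cdot> \<c> d e) \<otimes> \<delta> E) \<cdot> (\<delta> D \<otimes> \<delta> E)"
    unfolding whisk by (simp add: \<Delta>_def comp_reduce[OF slide])
  also have "\<dots> = ((\<one> (d \<otimes>\<^sub>o e \<otimes>\<^sub>o d) \<otimes> \<c> d e \<otimes> \<one> e) \<cdot> (\<one> d \<otimes> \<c> d e \<otimes> \<one> (d \<otimes>\<^sub>o e \<otimes>\<^sub>o e)))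
      \<cdot> (\<one> (d \<otimes>\<^sub>o d) \<otimes> \<c> d e \<otimes> \<one> (e \<otimes>\<^sub>o e)) \<cdot> ?\<delta>\<^sub>3"
    unfolding nat1 split by (simp flip: interchange)
  \<comment> \<open>The two crossings exchange the second and third strand and the fourth and fifth
    strand, hence commute.\<close>
  also have "(\<one> (d \<otimes>\<^sub>o e \<otimes>\<^sub>o d) \<otimes> \<c> d e \<otimes> \<one> e) \<cdot> (\<one> d \<otimes> \<c> d e \<otimes> \<one> (d \<otimes>\<^sub>o e \<otimes>\<^sub>o e)) =
      (\<one> d \<otimes> \<c> d e \<otimes> \<one> (e \<otimes>\<^sub>o d \<otimes>\<^sub>o e)) \<cdot> (\<one> (d \<otimes>\<^sub>o d \<otimes>\<^sub>o e) \<otimes> \<c> d e \<otimes> \<one> e)"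
    by (simp add: merge del: tensor_id tensor_id_id flip: tensor_id)
  also have "?\<delta>\<^sub>3 = ((\<delta> D \<otimes> \<one> d) \<cdot> \<delta> D) \<otimes> ((\<delta> E \<otimes> \<one> e) \<cdot> \<delta> E)"
    using coalgebraD(10)[OF D] coalgebraD(10)[OF E] by (simp add: d_def e_def)
  also have "((\<one> d \<otimes> \<c> d e \<otimes> \<one> (e \<otimes>\<^sub>o d \<otimes>\<^sub>o e)) \<cdot> (\<one> (d \<otimes>\<^sub>o d \<otimes>\<^sub>o e) \<otimes> \<c> d e \<otimes> \<one> e))
      \<cdot> (\<one> (d \<otimes>\<^sub>o d) \<otimes> \<c> d e \<otimes> \<one> (e \<otimes>\<^sub>o e)) \<cdot> (((\<delta> D \<otimes> \<one> d) \<cdot> \<delta> D) \<otimes> ((\<delta> E \<otimes> \<one> e) \<cdot> \<delta> E)) =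
    (\<one> d \<otimes> \<c> d e \<otimes> \<one> (e \<otimes>\<^sub>o d \<otimes>\<^sub>o e)) \<cdot> (\<delta> D \<otimes> ((\<delta> E \<otimes> \<one> d) \<cdot> \<c> d e) \<otimes> \<one> e) \<cdot> (\<delta> D \<otimes> \<delta> E)"
    unfolding nat2 split' by (simp flip: interchange)
  also have "\<dots> = (\<Delta> \<otimes> \<one> (d \<otimes>\<^sub>o e)) \<cdot> \<Delta>"
    unfolding whisk' by (simp add: \<Delta>_def comp_reduce[OF slide'])
  finally show ?thesis .
qed

lemma tensor_coalg_coalgebra:
  assumes D: "is_coalgebra D" and E: "is_coalgebra E"
  shows "is_coalgebra (tensor_coalg D E)"
proof -
  note [simp] = coalgebraD(1-7)[OF D] coalgebraD(1-7)[OF E]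
  show ?thesis
    unfolding is_coalgebra_def tensor_coalg_def
    using tensor_coalg_coassoc[OF D E] tensor_coalg_counit_left[OF D E] tensor_coalg_counit_right[OF D E]
    by (simp add: hom_iff)
qed

section \<open>Actions on a product, with the acting coalgebra crossing the first factor\<close>

definition cross_act ::
    "('o, 'm, 'z) coalg_data_scheme \<Rightarrow> 'm \<Rightarrow> 'o \<Rightarrow> 'o \<Rightarrow> 'm \<Rightarrow> 'm \<Rightarrow> 'm"
  where "cross_act D a Z M \<psi> \<beta> =
    a \<cdot> (\<psi> \<otimes> \<beta>) \<cdot> (\<one> (car D) \<otimes> \<c> (car D) Z \<otimes> \<one> M) \<cdot> (\<delta> D \<otimes> \<one> Z \<otimes> \<one> M)"

lemma cross_act_arr [simp]:
  assumes "is_coalgebra D" "left_module X M a" "Z \<in> Ob C"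
    and "\<psi> \<in> Ar C" "Dom C \<psi> = car D \<otimes>\<^sub>o Z" "Cod C \<psi> = car X"
    and "\<beta> \<in> Ar C" "Dom C \<beta> = car D \<otimes>\<^sub>o M" "Cod C \<beta> = M"
  shows "cross_act D a Z M \<psi> \<beta> \<in> Ar C" "Dom C (cross_act D a Z M \<psi> \<beta>) = car D \<otimes>\<^sub>o Z \<otimes>\<^sub>o M"
    "Cod C (cross_act D a Z M \<psi> \<beta>) = M"
  using assms coalgebraD[OF assms(1)] moduleD[OF assms(2)] by (simp_all add: cross_act_def)

text \<open>The extra leg f(x1) is absorbed into \<psi>(x2, z) by associativity of the module. With
  \<open>f\<close> an identity and \<psi> the lifted action of \<open>T\<close>, the absorbed factor
  is x1 \<phi>(T x2, z), the second product.\<close>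

lemma conv_act_cross_act:
  assumes D: "is_coalgebra D" and X: "is_algebra X" and a: "left_module X M a" and [simp]: "Z \<in> Ob C"
    and [simp]: "f \<in> Ar C" "Dom C f = car D" "Cod C f = car X"
    and [simp]: "\<psi> \<in> Ar C" "Dom C \<psi> = car D \<otimes>\<^sub>o Z" "Cod C \<psi> = car X"
    and [simp]: "\<beta> \<in> Ar C" "Dom C \<beta> = car D \<otimes>\<^sub>o M" "Cod C \<beta> = M"
  shows "conv_act D a (Z \<otimes>\<^sub>o M) f (cross_act D a Z M \<psi> \<beta>) =
    cross_act D a Z M (\<mu> X \<cdot> (f \<otimes> \<psi>) \<cdot> (\<delta> D \<otimes> \<one> Z)) \<beta>"
proof -
  note [simp] = coalgebraD(1-7)[OF D] moduleD(1-4)[OF a] algebraD(1-7)[OF X]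
  let ?d = "car D" and ?c = "\<c> (car D) Z"
  have "conv_act D a (Z \<otimes>\<^sub>o M) f (cross_act D a Z M \<psi> \<beta>) =
    a \<cdot> ((\<one> (car X) \<otimes> a) \<cdot> (f \<otimes> \<psi> \<otimes> \<beta>) \<cdot> (\<one> ?d \<otimes> \<one> ?d \<otimes> ?c \<otimes> \<one> M) \<cdot> (\<one> ?d \<otimes> \<delta> D \<otimes> \<one> (Z \<otimes>\<^sub>o M)))
      \<cdot> (\<delta> D \<otimes> \<one> (Z \<otimes>\<^sub>o M))"
    by (simp add: conv_act_def cross_act_def interchange interchange_comp del: tensor_id_id)
  also have "\<dots> = (a \<cdot> (\<one> (car X) \<otimes> a)) \<cdot> (f \<otimes> \<psi> \<otimes> \<beta>) \<cdot> (\<one> ?d \<otimes> \<one> ?d \<otimes> ?c \<otimes> \<one> M)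
      \<cdot> (((\<one> ?d \<otimes> \<delta> D) \<cdot> \<delta> D) \<otimes> \<one> (Z \<otimes>\<^sub>o M))"
    by (simp add: whisker_right)
  also have "\<dots> = a \<cdot> (\<mu> X \<otimes> \<one> M) \<cdot> ((f \<otimes> \<psi>) \<otimes> \<beta>)
      \<cdot> ((\<one> (?d \<otimes>\<^sub>o ?d) \<otimes> ?c \<otimes> \<one> M) \<cdot> (\<delta> D \<otimes> \<one> (?d \<otimes>\<^sub>o Z \<otimes>\<^sub>o M))) \<cdot> (\<delta> D \<otimes> \<one> (Z \<otimes>\<^sub>o M))"
    unfolding moduleD(6)[OF a] coalgebraD(10)[OF D] by (simp add: whisker_right)
  \<comment> \<open>The coproduct touches the first strand and the crossing the later ones, so they
    can be exchanged.\<close>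
  also have "(\<one> (?d \<otimes>\<^sub>o ?d) \<otimes> ?c \<otimes> \<one> M) \<cdot> (\<delta> D \<otimes> \<one> (?d \<otimes>\<^sub>o Z \<otimes>\<^sub>o M)) =
      ((\<delta> D \<otimes> \<one> Z) \<otimes> \<one> (?d \<otimes>\<^sub>o M)) \<cdot> (\<one> ?d \<otimes> ?c \<otimes> \<one> M)"
    by (simp add: merge del: tensor_id tensor_id_id flip: tensor_id)
  also have "a \<cdot> (\<mu> X \<otimes> \<one> M) \<cdot> ((f \<otimes> \<psi>) \<otimes> \<beta>) \<cdot>
      (((\<delta> D \<otimes> \<one> Z) \<otimes> \<one> (?d \<otimes>\<^sub>o M)) \<cdot> (\<one> ?d \<otimes> ?c \<otimes> \<one> M)) \<cdot> (\<delta> D \<otimes> \<one> (Z \<otimes>\<^sub>o M)) =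
    a \<cdot> ((\<mu> X \<otimes> \<one> M) \<cdot> ((f \<otimes> \<psi>) \<otimes> \<beta>) \<cdot> ((\<delta> D \<otimes> \<one> Z) \<otimes> \<one> (?d \<otimes>\<^sub>o M)))
      \<cdot> (\<one> ?d \<otimes> ?c \<otimes> \<one> M) \<cdot> (\<delta> D \<otimes> \<one> (Z \<otimes>\<^sub>o M))"
    by simp
  also have "(\<mu> X \<otimes> \<one> M) \<cdot> ((f \<otimes> \<psi>) \<otimes> \<beta>) \<cdot> ((\<delta> D \<otimes> \<one> Z) \<otimes> \<one> (?d \<otimes>\<^sub>o M)) =
      (\<mu> X \<cdot> (f \<otimes> \<psi>) \<cdot> (\<delta> D \<otimes> \<one> Z)) \<otimes> \<beta>"
    by (simp add: interchange interchange_comp del: tensor_assoc)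
  finally show ?thesis
    by (simp add: cross_act_def)
qed

text \<open>A coalgebra morphism passes the coproduct, and naturality carries its second copy
  through the crossing. This moves compatibility conditions along \<open>T\<close> and back along
  its inverse.\<close>

lemma cross_act_comp:
  assumes k: "coalg_morphism D E k" and D: "is_coalgebra D" and E: "is_coalgebra E"
    and a: "left_module X M a" and [simp]: "Z \<in> Ob C"
    and [simp]: "\<psi> \<in> Ar C" "Dom C \<psi> = car E \<otimes>\<^sub>o Z" "Cod C \<psi> = car X"
    and [simp]: "\<beta> \<in> Ar C" "Dom C \<beta> = car E \<otimes>\<^sub>o M" "Cod C \<beta> = M"
  shows "cross_act E a Z M \<psi> \<beta> \<cdot> (k \<otimes> \<one> (Z \<otimes>\<^sub>o M)) =
    cross_act D a Z M (\<psi> \<cdot> (k \<otimes> \<one> Z)) (\<beta> \<cdot> (k \<otimes> \<one> M))"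
proof -
  note [simp] = coalgebraD(1-7)[OF D] coalgebraD(1-7)[OF E] moduleD(1-4)[OF a] coalg_morphismD(1-3)[OF k]
  let ?d = "car D" and ?e = "car E"
  have nat: "\<c> ?e Z \<cdot> (k \<otimes> \<one> Z) = (\<one> Z \<otimes> k) \<cdot> \<c> ?d Z"
    by (rule braid_natural_left) simp_all
  have "cross_act E a Z M \<psi> \<beta> \<cdot> (k \<otimes> \<one> (Z \<otimes>\<^sub>o M)) =
    a \<cdot> (\<psi> \<otimes> \<beta>) \<cdot> (\<one> ?e \<otimes> \<c> ?e Z \<otimes> \<one> M) \<cdot> ((\<delta> E \<cdot> k) \<otimes> \<one> (Z \<otimes>\<^sub>o M))"
    by (simp add: cross_act_def whisker_right)
  also have "\<dots> = a \<cdot> (\<psi> \<otimes> \<beta>) \<cdot>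
      ((\<one> ?e \<otimes> \<c> ?e Z \<otimes> \<one> M) \<cdot> (k \<otimes> (k \<otimes> \<one> Z) \<otimes> \<one> M)) \<cdot> (\<delta> D \<otimes> \<one> (Z \<otimes>\<^sub>o M))"
    unfolding coalg_morphismD(5)[OF k] by (simp add: whisker_right)
  also have "(\<one> ?e \<otimes> \<c> ?e Z \<otimes> \<one> M) \<cdot> (k \<otimes> (k \<otimes> \<one> Z) \<otimes> \<one> M) =
      k \<otimes> (\<c> ?e Z \<cdot> (k \<otimes> \<one> Z)) \<otimes> \<one> M"
    by (simp add: interchange del: tensor_assoc)
  also have "\<dots> = ((k \<otimes> \<one> Z) \<otimes> (k \<otimes> \<one> M)) \<cdot> (\<one> ?d \<otimes> \<c> ?d Z \<otimes> \<one> M)"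
    unfolding nat by (simp add: merge del: tensor_id tensor_id_id)
  also have "a \<cdot> (\<psi> \<otimes> \<beta>) \<cdot> (((k \<otimes> \<one> Z) \<otimes> (k \<otimes> \<one> M)) \<cdot> (\<one> ?d \<otimes> \<c> ?d Z \<otimes> \<one> M))
      \<cdot> (\<delta> D \<otimes> \<one> (Z \<otimes>\<^sub>o M)) =
    a \<cdot> ((\<psi> \<otimes> \<beta>) \<cdot> ((k \<otimes> \<one> Z) \<otimes> (k \<otimes> \<one> M))) \<cdot> (\<one> ?d \<otimes> \<c> ?d Z \<otimes> \<one> M)
      \<cdot> (\<delta> D \<otimes> \<one> (Z \<otimes>\<^sub>o M))"
    by simp
  also have "(\<psi> \<otimes> \<beta>) \<cdot> ((k \<otimes> \<one> Z) \<otimes> (k \<otimes> \<one> M)) = (\<psi> \<cdot> (k \<otimes> \<one> Z)) \<otimes> (\<beta> \<cdot> (k \<otimes> \<one> M))"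
    by (simp add: interchange del: tensor_assoc)
  finally show ?thesis
    by (simp add: cross_act_def)
qed

text \<open>Inserting y1 and \<Theta>(y2, m) produces \<psi>(x1, y1) \<cdot> \<beta>(x2,
  \<Theta>(y2, m)). The crossing of x2 past y1 is exactly the one in the coproduct of D \<otimes> E,
  so the result is a convolution action over that coalgebra.\<close>

lemma cross_act_tensor:
  assumes D: "is_coalgebra D" and E: "is_coalgebra E" and a: "left_module X M a"
    and [simp]: "\<psi> \<in> Ar C" "Dom C \<psi> = car D \<otimes>\<^sub>o car E" "Cod C \<psi> = car X"
    and [simp]: "\<beta> \<in> Ar C" "Dom C \<beta> = car D \<otimes>\<^sub>o M" "Cod C \<beta> = M"
    and [simp]: "\<Theta> \<in> Ar C" "Dom C \<Theta> = car E \<otimes>\<^sub>o M" "Cod C \<Theta> = M"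
  shows "cross_act D a (car E) M \<psi> \<beta> \<cdot> (\<one> (car D) \<otimes> ((\<one> (car E) \<otimes> \<Theta>) \<cdot> (\<delta> E \<otimes> \<one> M))) =
    conv_act (tensor_coalg D E) a M \<psi> (\<beta> \<cdot> (\<one> (car D) \<otimes> \<Theta>))"
proof -
  note [simp] = coalgebraD(1-7)[OF D] coalgebraD(1-7)[OF E] moduleD(1-4)[OF a]
  let ?d = "car D" and ?e = "car E" and ?c = "\<c> (car D) (car E)"
  have 1: "(\<delta> D \<otimes> \<one> ?e \<otimes> \<one> M) \<cdot> (\<one> ?d \<otimes> ((\<one> ?e \<otimes> \<Theta>) \<cdot> (\<delta> E \<otimes> \<one> M))) =
      (\<one> (?d \<otimes>\<^sub>o ?d) \<otimes> (\<one> ?e \<otimes> \<Theta>)) \<cdot> (\<delta> D \<otimes> \<delta> E \<otimes> \<one> M)"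
    by (simp add: interchange interchange_comp del: tensor_id_id)
  have 2: "(\<one> ?d \<otimes> ?c \<otimes> \<one> M) \<cdot> (\<one> (?d \<otimes>\<^sub>o ?d) \<otimes> (\<one> ?e \<otimes> \<Theta>)) =
      (\<one> (?d \<otimes>\<^sub>o ?e) \<otimes> (\<one> ?d \<otimes> \<Theta>)) \<cdot> (\<one> ?d \<otimes> ?c \<otimes> \<one> (?e \<otimes>\<^sub>o M))"
    by (simp add: merge del: tensor_id tensor_id_id flip: tensor_id)
  have 3: "(\<psi> \<otimes> \<beta>) \<cdot> (\<one> (?d \<otimes>\<^sub>o ?e) \<otimes> (\<one> ?d \<otimes> \<Theta>)) = \<psi> \<otimes> (\<beta> \<cdot> (\<one> ?d \<otimes> \<Theta>))"
    by (simp add: interchange del: tensor_id_id)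
  have "cross_act D a ?e M \<psi> \<beta> \<cdot> (\<one> ?d \<otimes> ((\<one> ?e \<otimes> \<Theta>) \<cdot> (\<delta> E \<otimes> \<one> M))) =
    a \<cdot> (\<psi> \<otimes> \<beta>) \<cdot> (\<one> ?d \<otimes> ?c \<otimes> \<one> M) \<cdot>
      ((\<delta> D \<otimes> \<one> ?e \<otimes> \<one> M) \<cdot> (\<one> ?d \<otimes> ((\<one> ?e \<otimes> \<Theta>) \<cdot> (\<delta> E \<otimes> \<one> M))))"
    by (simp add: cross_act_def)
  also have "\<dots> = a \<cdot> (\<psi> \<otimes> \<beta>) \<cdot>
      ((\<one> ?d \<otimes> ?c \<otimes> \<one> M) \<cdot> (\<one> (?d \<otimes>\<^sub>o ?d) \<otimes> (\<one> ?e \<otimes> \<Theta>))) \<cdot> (\<delta> D \<otimes> \<delta> E \<otimes> \<one> M)"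
    unfolding 1 by simp
  also have "\<dots> = a \<cdot> ((\<psi> \<otimes> \<beta>) \<cdot> (\<one> (?d \<otimes>\<^sub>o ?e) \<otimes> (\<one> ?d \<otimes> \<Theta>)))
      \<cdot> (\<one> ?d \<otimes> ?c \<otimes> \<one> (?e \<otimes>\<^sub>o M)) \<cdot> (\<delta> D \<otimes> \<delta> E \<otimes> \<one> M)"
    unfolding 2 by simp
  also have "\<dots> = conv_act (tensor_coalg D E) a M \<psi> (\<beta> \<cdot> (\<one> ?d \<otimes> \<Theta>))"
    unfolding 3 by (simp add: conv_act_def tensor_coalg_def whisker_right)
  finally show ?thesis .
qed

section \<open>Cancellation by convolution inverses, and transport along morphisms\<close>

lemma conv_act_cancel:
  assumes D: "is_coalgebra D" and X: "is_algebra X" and a: "left_module X M a" and Y: "Y \<in> Ob C"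
    and f: "f \<in> Ar C" "Dom C f = car D" "Cod C f = car X"
    and g: "g \<in> Ar C" "Dom C g = car D" "Cod C g = car X"
    and inv: "\<mu> X \<cdot> (g \<otimes> f) \<cdot> \<delta> D = \<eta> X \<cdot> \<epsilon> D"
    and \<Theta>: "\<Theta> \<in> Ar C" "Dom C \<Theta> = car D \<otimes>\<^sub>o Y" "Cod C \<Theta> = M"
  shows "conv_act D a Y g (conv_act D a Y f \<Theta>) = \<Theta>"
  using conv_act_conv_act[OF D X a Y g f \<Theta>] conv_act_unit[OF D X a Y \<Theta>] inv by simp

lemma coalg_morphism_comp:
  assumes k: "coalg_morphism D E k" and l: "coalg_morphism E F l" and D: "is_coalgebra D"
    and E: "is_coalgebra E" and F: "is_coalgebra F"
  shows "coalg_morphism D F (l \<cdot> k)"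
proof -
  note [simp] = coalgebraD(1-7)[OF D] coalgebraD(1-7)[OF E] coalgebraD(1-7)[OF F]
    coalg_morphismD(1-3)[OF k] coalg_morphismD(1-3)[OF l]
  have "\<delta> F \<cdot> (l \<cdot> k) = (l \<otimes> l) \<cdot> (\<delta> E \<cdot> k)"
    by (simp add: comp_reduce[OF coalg_morphismD(5)[OF l]])
  then show ?thesis
    using coalg_morphismD(4)[OF k] coalg_morphismD(5)[OF k]
    by (simp add: coalg_morphism_def hom_iff comp_reduce[OF coalg_morphismD(4)[OF l]] interchange_comp)
qed

lemma coalg_morphism_tensor:
  assumes k: "coalg_morphism D D' k" and l: "coalg_morphism E E' l"
    and D: "is_coalgebra D" "is_coalgebra D'" and E: "is_coalgebra E" "is_coalgebra E'"
  shows "coalg_morphism (tensor_coalg D E) (tensor_coalg D' E') (k \<otimes> l)"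
proof -
  note [simp] = coalgebraD(1-7)[OF D(1)] coalgebraD(1-7)[OF D(2)] coalgebraD(1-7)[OF E(1)]
    coalgebraD(1-7)[OF E(2)] coalg_morphismD(1-3)[OF k] coalg_morphismD(1-3)[OF l]
  have nat: "\<c> (car D') (car E') \<cdot> (k \<otimes> l) = (l \<otimes> k) \<cdot> \<c> (car D) (car E)"
    by (rule braid_natural) (simp_all add: hom_iff)
  have "\<delta> (tensor_coalg D' E') \<cdot> (k \<otimes> l) =
    (\<one> (car D') \<otimes> \<c> (car D') (car E') \<otimes> \<one> (car E')) \<cdot> ((\<delta> D' \<cdot> k) \<otimes> (\<delta> E' \<cdot> l))"
    by (simp add: tensor_coalg_def interchange)
  also have "\<dots> = ((\<one> (car D') \<otimes> \<c> (car D') (car E') \<otimes> \<one> (car E')) \<cdot> (k \<otimes> (k \<otimes> l) \<otimes> l))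
      \<cdot> (\<delta> D \<otimes> \<delta> E)"
    unfolding coalg_morphismD(5)[OF k] coalg_morphismD(5)[OF l] by (simp flip: interchange)
  also have "(\<one> (car D') \<otimes> \<c> (car D') (car E') \<otimes> \<one> (car E')) \<cdot> (k \<otimes> (k \<otimes> l) \<otimes> l) =
      k \<otimes> (\<c> (car D') (car E') \<cdot> (k \<otimes> l)) \<otimes> l"
    by (simp add: interchange del: tensor_assoc)
  also have "\<dots> = (k \<otimes> l \<otimes> k \<otimes> l) \<cdot> (\<one> (car D) \<otimes> \<c> (car D) (car E) \<otimes> \<one> (car E))"
    unfolding nat by (simp add: merge)
  finally have "\<delta> (tensor_coalg D' E') \<cdot> (k \<otimes> l) = ((k \<otimes> l) \<otimes> (k \<otimes> l)) \<cdot> \<delta> (tensor_coalg D E)"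
    by (simp add: tensor_coalg_def)
  then show ?thesis
    using coalg_morphismD(4)[OF k] coalg_morphismD(4)[OF l]
    by (simp add: coalg_morphism_def hom_iff interchange) (simp add: tensor_coalg_def interchange)
qed

text \<open>Precomposition with a coalgebra morphism respects convolution, so it carries the
  antipode, which is inverse to the identity, to an inverse of \<open>k\<close>.\<close>

lemma antipode_comp_conv_inverse:
  assumes H: "is_hopf_algebra H" and k: "coalg_morphism D H k" and D: "is_coalgebra D"
  shows "\<mu> H \<cdot> ((antipode H \<cdot> k) \<otimes> k) \<cdot> \<delta> D = \<eta> H \<cdot> \<epsilon> D"
proof -
  have X: "is_algebra H" "is_coalgebra H" and [simp]: "antipode H \<in> Ar C" "Dom C (antipode H) = car H"
    "Cod C (antipode H) = car H" and S: "\<mu> H \<cdot> (antipode H \<otimes> \<one> (car H)) \<cdot> \<delta> H = \<eta> H \<cdot> \<epsilon> H"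
    using H by (auto simp: is_hopf_algebra_def hom_iff)
  note [simp] = algebraD(1-7)[OF X(1)] coalgebraD(1-7)[OF X(2)] coalgebraD(1-7)[OF D] coalg_morphismD(1-3)[OF k]
  have "\<mu> H \<cdot> ((antipode H \<cdot> k) \<otimes> k) \<cdot> \<delta> D = \<mu> H \<cdot> (antipode H \<otimes> \<one> (car H)) \<cdot> ((k \<otimes> k) \<cdot> \<delta> D)"
    by (simp add: interchange_comp)
  also have "\<dots> = (\<mu> H \<cdot> (antipode H \<otimes> \<one> (car H)) \<cdot> \<delta> H) \<cdot> k"
    by (simp flip: coalg_morphismD(5)[OF k])
  also have "\<dots> = \<eta> H \<cdot> \<epsilon> D"
    unfolding S by (simp flip: coalg_morphismD(4)[OF k])
  finally show ?thesis .
qed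

text \<open>Combines restriction along a unital multiplicative \<open>k\<close> with transport along
  an isomorphism \<open>g\<close> of underlying objects; inside the iterated action
  \<open>g \<cdot> g'\<close> cancels. It serves with \<open>T\<close> and \<gamma> to obtain
  actions of \<open>Hbar\<close>, and with the inverse of \<open>T\<close> and an identity to obtain
  actions of \<open>B\<close>.\<close>

lemma module_pullback:
  assumes n: "left_module X N n"
    and X [simp]: "car X \<in> Ob C" "\<eta> X \<in> hom \<K> (car X)" "\<mu> X \<in> hom (car X \<otimes>\<^sub>o car X) (car X)"
    and Y [simp]: "car Y \<in> Ob C" "\<eta> Y \<in> hom \<K> (car Y)" "\<mu> Y \<in> hom (car Y \<otimes>\<^sub>o car Y) (car Y)"
    and k: "k \<in> hom (car Y) (car X)" "k \<cdot> \<eta> Y = \<eta> X" "k \<cdot> \<mu> Y = \<mu> X \<cdot> (k \<otimes> k)"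
    and g: "g \<in> hom M N" "g' \<in> hom N M" "g' \<cdot> g = \<one> M" "g \<cdot> g' = \<one> N"
  shows "left_module Y M (g' \<cdot> n \<cdot> (k \<otimes> g))"
proof -
  have [simp]: "\<eta> Y \<in> Ar C" "Dom C (\<eta> Y) = \<K>" "Cod C (\<eta> Y) = car Y"
    "\<mu> Y \<in> Ar C" "Dom C (\<mu> Y) = car Y \<otimes>\<^sub>o car Y" "Cod C (\<mu> Y) = car Y"
    "k \<in> Ar C" "Dom C k = car Y" "Cod C k = car X"
    "g \<in> Ar C" "Dom C g = M" "Cod C g = N" "g' \<in> Ar C" "Dom C g' = N" "Cod C g' = M"
    "\<eta> X \<in> Ar C" "Dom C (\<eta> X) = \<K>" "Cod C (\<eta> X) = car X"
    "\<mu> X \<in> Ar C" "Dom C (\<mu> X) = car X \<otimes>\<^sub>o car X" "Cod C (\<mu> X) = car X"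
    using X Y k g by (auto simp: hom_iff)
  note [simp] = moduleD(1-4)[OF n]
  have M [simp]: "M \<in> Ob C"
    using ob_of_arr[OF g(1)] by simp
  have "(g' \<cdot> n \<cdot> (k \<otimes> g)) \<cdot> (\<eta> Y \<otimes> \<one> M) = g' \<cdot> n \<cdot> ((k \<cdot> \<eta> Y) \<otimes> (\<one> N \<cdot> g))"
    by (simp add: interchange)
  also have "\<dots> = g' \<cdot> n \<cdot> ((\<eta> X \<otimes> \<one> N) \<cdot> (\<one> \<K> \<otimes> g))"
    by (simp add: k(2) interchange del: tensor_unit_left tensor_unit_right)
  also have "\<dots> = g' \<cdot> (n \<cdot> (\<eta> X \<otimes> \<one> N)) \<cdot> g"
    by simp
  also have "\<dots> = \<one> M"
    unfolding moduleD(5)[OF n] by (simp add: g(3))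
  finally have unit: "(g' \<cdot> n \<cdot> (k \<otimes> g)) \<cdot> (\<eta> Y \<otimes> \<one> M) = \<one> M" .
  have "(g' \<cdot> n \<cdot> (k \<otimes> g)) \<cdot> (\<one> (car Y) \<otimes> (g' \<cdot> n \<cdot> (k \<otimes> g))) =
    g' \<cdot> n \<cdot> (k \<otimes> ((g \<cdot> g') \<cdot> n \<cdot> (k \<otimes> g)))"
    by (simp add: interchange)
  also have "\<dots> = g' \<cdot> (n \<cdot> (\<one> (car X) \<otimes> n)) \<cdot> (k \<otimes> k \<otimes> g)"
    unfolding g(4) by (simp add: interchange)
  also have "\<dots> = g' \<cdot> n \<cdot> ((\<mu> X \<otimes> \<one> N) \<cdot> ((k \<otimes> k) \<otimes> g))"
    unfolding moduleD(6)[OF n] by simp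
  also have "(\<mu> X \<otimes> \<one> N) \<cdot> ((k \<otimes> k) \<otimes> g) = (k \<cdot> \<mu> Y) \<otimes> g"
    unfolding k(3) by (simp add: interchange del: tensor_assoc)
  also have "\<dots> = (k \<otimes> g) \<cdot> (\<mu> Y \<otimes> \<one> M)"
    by (simp add: interchange)
  finally have "(g' \<cdot> n \<cdot> (k \<otimes> g)) \<cdot> (\<one> (car Y) \<otimes> (g' \<cdot> n \<cdot> (k \<otimes> g))) =
    (g' \<cdot> n \<cdot> (k \<otimes> g)) \<cdot> (\<mu> Y \<otimes> \<one> M)"
    by simp
  with unit show ?thesis
    by (simp add: left_module_def hom_iff)
qed

lemma conv_act_postcomp:
  assumes D: "is_coalgebra D" and a: "left_module X M a" and a': "left_module X P a'"
    and r: "r \<in> hom M P" "r \<cdot> a = a' \<cdot> (\<one> (car X) \<otimes> r)" and [simp]: "car X \<in> Ob C" "Y \<in> Ob C"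
    and [simp]: "f \<in> Ar C" "Dom C f = car D" "Cod C f = car X"
    and [simp]: "\<Theta> \<in> Ar C" "Dom C \<Theta> = car D \<otimes>\<^sub>o Y" "Cod C \<Theta> = M"
  shows "r \<cdot> conv_act D a Y f \<Theta> = conv_act D a' Y f (r \<cdot> \<Theta>)"
proof -
  note [simp] = coalgebraD(1-7)[OF D] moduleD(1-4)[OF a] moduleD(1-4)[OF a']
  have [simp]: "r \<in> Ar C" "Dom C r = M" "Cod C r = P"
    using r(1) by (auto simp: hom_iff)
  show ?thesis
    by (simp add: conv_act_def comp_reduce[OF r(2)] interchange_comp)
qed

lemma conv_act_precomp:
  assumes D: "is_coalgebra D" and a: "left_module X M a" and s: "s \<in> hom Y' Y"
    and [simp]: "f \<in> Ar C" "Dom C f = car D" "Cod C f = car X"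
    and [simp]: "\<Theta> \<in> Ar C" "Dom C \<Theta> = car D \<otimes>\<^sub>o Y" "Cod C \<Theta> = M"
  shows "conv_act D a Y f \<Theta> \<cdot> (\<one> (car D) \<otimes> s) = conv_act D a Y' f (\<Theta> \<cdot> (\<one> (car D) \<otimes> s))"
proof -
  note [simp] = coalgebraD(1-7)[OF D] moduleD(1-4)[OF a]
  have [simp]: "s \<in> Ar C" "Dom C s = Y'" "Cod C s = Y" "Y \<in> Ob C" "Y' \<in> Ob C"
    using s ob_of_arr[OF s] by (auto simp: hom_iff)
  have "(\<delta> D \<otimes> \<one> Y) \<cdot> (\<one> (car D) \<otimes> s) = (\<one> (car D) \<otimes> (\<one> (car D) \<otimes> s)) \<cdot> (\<delta> D \<otimes> \<one> Y')"
    by (simp add: interchange)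
  then have "conv_act D a Y f \<Theta> \<cdot> (\<one> (car D) \<otimes> s) =
      a \<cdot> ((f \<otimes> \<Theta>) \<cdot> (\<one> (car D) \<otimes> (\<one> (car D) \<otimes> s))) \<cdot> (\<delta> D \<otimes> \<one> Y')"
    by (simp add: conv_act_def del: tensor_id_id)
  then show ?thesis
    by (simp add: conv_act_def interchange del: tensor_id_id)
qed

lemma coalg_morphism_inverse:
  assumes k: "coalg_morphism D E k" and D: "is_coalgebra D" and E: "is_coalgebra E"
    and l: "l \<in> hom (car E) (car D)" "l \<cdot> k = \<one> (car D)" "k \<cdot> l = \<one> (car E)"
  shows "coalg_morphism E D l"
proof -
  note [simp] = coalgebraD(1-7)[OF D] coalgebraD(1-7)[OF E] coalg_morphismD(1-3)[OF k]
  have [simp]: "l \<in> Ar C" "Dom C l = car E" "Cod C l = car D"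
    using l by (auto simp: hom_iff)
  have "\<delta> D \<cdot> l = (l \<otimes> l) \<cdot> ((k \<otimes> k) \<cdot> \<delta> D) \<cdot> l"
    by (simp add: interchange_comp l(2))
  also have "\<dots> = (l \<otimes> l) \<cdot> \<delta> E \<cdot> (k \<cdot> l)"
    by (simp flip: coalg_morphismD(5)[OF k])
  finally have "\<delta> D \<cdot> l = (l \<otimes> l) \<cdot> \<delta> E"
    by (simp add: l(3))
  moreover have "\<epsilon> D \<cdot> l = \<epsilon> E \<cdot> (k \<cdot> l)"
    by (simp flip: coalg_morphismD(4)[OF k])
  ultimately show ?thesis
    using l by (simp add: coalg_morphism_def)
qed

lemma hopfD:
  assumes "is_hopf_algebra H"
  shows "is_algebra H" "is_coalgebra H" "coalg_morphism (tensor_coalg H H) H (\<mu> H)"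
    "antipode H \<in> Ar C" "Dom C (antipode H) = car H" "Cod C (antipode H) = car H"
    "\<mu> H \<cdot> (\<one> (car H) \<otimes> antipode H) \<cdot> \<delta> H = \<eta> H \<cdot> \<epsilon> H"
    "\<mu> H \<cdot> (antipode H \<otimes> \<one> (car H)) \<cdot> \<delta> H = \<eta> H \<cdot> \<epsilon> H"
  using assms by (auto simp: is_hopf_algebra_def hom_iff)

text \<open>The unit is group-like, so the antipode equation evaluated at it reads \<lambda>(1) 1 =
  \<epsilon>(1) 1.\<close>

lemma antipode_unit:
  assumes H: "is_hopf_algebra H"
  shows "antipode H \<cdot> \<eta> H = \<eta> H"
proof -
  note [simp] = algebraD(1-7)[OF hopfD(1)[OF H]] coalgebraD(1-7)[OF hopfD(2)[OF H]] hopfD(4-6)[OF H]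
  have u: "\<epsilon> H \<cdot> \<eta> H = \<one> \<K>" "\<delta> H \<cdot> \<eta> H = \<eta> H \<otimes> \<eta> H"
    using H by (auto simp: is_hopf_algebra_def coalg_morphism_def unit_coalg_def hom_iff)
  have "antipode H \<cdot> \<eta> H = (\<mu> H \<cdot> (\<one> (car H) \<otimes> \<eta> H)) \<cdot> (antipode H \<cdot> \<eta> H)"
    unfolding algebraD(8)[OF hopfD(1)[OF H]] by simp
  also have "\<dots> = \<mu> H \<cdot> ((\<one> (car H) \<otimes> \<eta> H) \<cdot> ((antipode H \<cdot> \<eta> H) \<otimes> \<one> \<K>))"
    by simp
  also have "\<dots> = \<mu> H \<cdot> (antipode H \<otimes> \<one> (car H)) \<cdot> (\<delta> H \<cdot> \<eta> H)"
    unfolding u by (simp add: interchange del: tensor_unit_left tensor_unit_right)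
  also have "\<dots> = (\<mu> H \<cdot> (antipode H \<otimes> \<one> (car H)) \<cdot> \<delta> H) \<cdot> \<eta> H"
    by simp
  also have "\<dots> = \<eta> H"
    unfolding hopfD(8)[OF H] by (simp add: u(1))
  finally show ?thesis .
qed

end

section \<open>Invertible relative Rota-Baxter operators\<close>

locale rota_baxter_iso = braided_cat C for C :: "('o, 'm) braided_data" (structure) +
  fixes H B :: "('o, 'm) hopf_data" and T \<phi> S :: 'm
  assumes rota_baxter: "rel_rota_baxter H B T \<phi>"
    and inverse_hom: "S \<in> hom (car B) (car H)"
    and inverse_left: "S \<cdot> T = \<one> (car H)"
    and inverse_right: "T \<cdot> S = \<one> (car B)"
begin

abbreviation Hbar :: "('o, 'm) hopf_data"
  where "Hbar \<equiv> snd (associated_brace H B T \<phi>)"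

lemma Hbar_simps [simp]:
  "car Hbar = car H" "\<eta> Hbar = \<eta> H"
  by (simp_all add: associated_brace_def)

lemma hopf: "is_hopf_algebra H" "is_hopf_algebra B"
  using rota_baxter by (simp_all add: rel_rota_baxter_def)

lemmas alg = hopfD(1)[OF hopf(1)] hopfD(1)[OF hopf(2)]
lemmas coalg = hopfD(2)[OF hopf(1)] hopfD(2)[OF hopf(2)]

lemma T_coalg: "coalg_morphism H B T"
  using rota_baxter by (simp add: rel_rota_baxter_def)

lemma S_coalg: "coalg_morphism B H S"
  by (rule coalg_morphism_inverse[OF T_coalg coalg inverse_hom inverse_left inverse_right])

lemma action_module: "left_module B (car H) \<phi>"
  using rota_baxter by (simp add: rel_rota_baxter_def module_algebra_coalgebra_def)

lemmas structure_simps [simp] = algebraD(1-7)[OF alg(1)] algebraD(1-7)[OF alg(2)]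
  coalgebraD(1-7)[OF coalg(1)] coalgebraD(1-7)[OF coalg(2)] hopfD(4-6)[OF hopf(1)]
  coalg_morphismD(1-3)[OF T_coalg] coalg_morphismD(1-3)[OF S_coalg] moduleD(1-4)[OF action_module]

abbreviation lift_action :: 'm
  where "lift_action \<equiv> \<phi> \<cdot> (T \<otimes> \<one> (car H))"

lemma mu_Hbar: "\<mu> Hbar = \<mu> H \<cdot> (\<one> (car H) \<otimes> lift_action) \<cdot> (\<delta> H \<otimes> \<one> (car H))"
  by (simp add: associated_brace_def)

lemma mu_Hbar_arr [simp]:
  "\<mu> Hbar \<in> Ar C" "Dom C (\<mu> Hbar) = car H \<otimes>\<^sub>o car H" "Cod C (\<mu> Hbar) = car H"
  by (simp_all add: mu_Hbar)

text \<open>This is the Rota-Baxter equation itself, whose right-hand side is \<open>T\<close> after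
  the second product.\<close>

lemma T_mult: "T \<cdot> \<mu> Hbar = \<mu> B \<cdot> (T \<otimes> T)"
  using rota_baxter by (simp add: rel_rota_baxter_def mu_Hbar)

lemma mu_Hbar_transport: "\<mu> Hbar = S \<cdot> \<mu> B \<cdot> (T \<otimes> T)"
proof -
  have "(S \<cdot> T) \<cdot> \<mu> Hbar = S \<cdot> \<mu> B \<cdot> (T \<otimes> T)"
    using T_mult by simp
  then show ?thesis
    by (simp add: inverse_left)
qed

text \<open>The transported form is a composite of coalgebra morphisms; the explicit formula would
  require reordering the copies of x made by the coproduct.\<close>

lemma mu_Hbar_coalg: "coalg_morphism (tensor_coalg H H) H (\<mu> Hbar)"
proof -
  have "coalg_morphism (tensor_coalg H H) (tensor_coalg B B) (T \<otimes> T)"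
    by (rule coalg_morphism_tensor[OF T_coalg T_coalg coalg coalg])
  from coalg_morphism_comp[OF this hopfD(3)[OF hopf(2)]]
  have "coalg_morphism (tensor_coalg H H) B (\<mu> B \<cdot> (T \<otimes> T))"
    by (simp add: tensor_coalg_coalgebra coalg)
  from coalg_morphism_comp[OF this S_coalg] show ?thesis
    unfolding mu_Hbar_transport by (simp add: tensor_coalg_coalgebra coalg)
qed

lemma S_mult: "S \<cdot> \<mu> B = \<mu> Hbar \<cdot> (S \<otimes> S)"
  by (simp add: mu_Hbar_transport interchange inverse_right)

text \<open>\<open>\<eta> H\<close> is a right unit of \<open>\<mu> Hbar\<close> and the transported unit \<open>S \<cdot> \<eta> B\<close> a left one, so they agree.\<close>

lemma T_unit: "T \<cdot> \<eta> H = \<eta> B"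
proof -
  have act: "\<phi> \<cdot> (\<one> (car B) \<otimes> \<eta> H) = \<epsilon> B \<otimes> \<eta> H"
    using rota_baxter by (simp add: rel_rota_baxter_def module_algebra_coalgebra_def)
  have "lift_action \<cdot> (\<one> (car H) \<otimes> \<eta> H) = (\<phi> \<cdot> (\<one> (car B) \<otimes> \<eta> H)) \<cdot> T"
    using interchange[of T "\<one> (car B)" "\<one> \<K>" "\<eta> H"] by (simp add: interchange)
  also have "\<dots> = (\<epsilon> B \<cdot> T) \<otimes> \<eta> H"
    unfolding act using interchange[of T "\<epsilon> B" "\<one> \<K>" "\<eta> H"] by simp
  also have "\<dots> = \<eta> H \<cdot> \<epsilon> H"
    using interchange[of "\<epsilon> H" "\<one> \<K>" "\<one> \<K>" "\<eta> H"] coalg_morphismD(4)[OF T_coalg] by simp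
  finally have lift: "lift_action \<cdot> (\<one> (car H) \<otimes> \<eta> H) = \<eta> H \<cdot> \<epsilon> H" .
  have "\<mu> Hbar \<cdot> (\<one> (car H) \<otimes> \<eta> H) =
      \<mu> H \<cdot> (\<one> (car H) \<otimes> lift_action) \<cdot> ((\<delta> H \<otimes> \<one> (car H)) \<cdot> (\<one> (car H) \<otimes> \<eta> H))"
    by (simp add: mu_Hbar)
  also have "(\<delta> H \<otimes> \<one> (car H)) \<cdot> (\<one> (car H) \<otimes> \<eta> H) = (\<one> (car H) \<otimes> (\<one> (car H) \<otimes> \<eta> H)) \<cdot> (\<delta> H \<otimes> \<one> \<K>)"
    by (simp add: interchange del: tensor_unit_left tensor_unit_right)
  also have "\<mu> H \<cdot> (\<one> (car H) \<otimes> lift_action) \<cdot> \<dots> =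
      \<mu> H \<cdot> (\<one> (car H) \<otimes> (lift_action \<cdot> (\<one> (car H) \<otimes> \<eta> H))) \<cdot> \<delta> H"
    by (simp add: interchange_comp del: tensor_id_id)
  also have "\<dots> = (\<mu> H \<cdot> (\<one> (car H) \<otimes> \<eta> H)) \<cdot> ((\<one> (car H) \<otimes> \<epsilon> H) \<cdot> \<delta> H)"
    unfolding lift by (simp add: interchange_comp)
  also have "\<dots> = \<one> (car H)"
    unfolding algebraD(8)[OF alg(1)] coalgebraD(8)[OF coalg(1)] by simp
  finally have right: "\<mu> Hbar \<cdot> (\<one> (car H) \<otimes> \<eta> H) = \<one> (car H)" .
  have "\<mu> Hbar \<cdot> ((S \<cdot> \<eta> B) \<otimes> \<one> (car H)) = S \<cdot> \<mu> B \<cdot> (((T \<cdot> S) \<cdot> \<eta> B) \<otimes> T)"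
    by (simp add: mu_Hbar_transport interchange)
  also have "\<dots> = S \<cdot> \<mu> B \<cdot> ((\<eta> B \<otimes> \<one> (car B)) \<cdot> (\<one> \<K> \<otimes> T))"
    unfolding inverse_right by (simp add: interchange del: tensor_unit_left tensor_unit_right)
  also have "\<dots> = S \<cdot> (\<mu> B \<cdot> (\<eta> B \<otimes> \<one> (car B))) \<cdot> T"
    by simp
  also have "\<dots> = \<one> (car H)"
    unfolding algebraD(9)[OF alg(2)] by (simp add: inverse_left)
  finally have left: "\<mu> Hbar \<cdot> ((S \<cdot> \<eta> B) \<otimes> \<one> (car H)) = \<one> (car H)" .
  have "\<eta> H = (\<mu> Hbar \<cdot> ((S \<cdot> \<eta> B) \<otimes> \<one> (car H))) \<cdot> (\<one> \<K> \<otimes> \<eta> H)"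
    unfolding left by simp
  also have "\<dots> = \<mu> Hbar \<cdot> ((\<one> (car H) \<otimes> \<eta> H) \<cdot> ((S \<cdot> \<eta> B) \<otimes> \<one> \<K>))"
    by (simp add: interchange del: tensor_unit_left tensor_unit_right)
  also have "\<dots> = (\<mu> Hbar \<cdot> (\<one> (car H) \<otimes> \<eta> H)) \<cdot> (S \<cdot> \<eta> B)"
    by simp
  also have "\<dots> = S \<cdot> \<eta> B"
    unfolding right by simp
  finally have "T \<cdot> \<eta> H = (T \<cdot> S) \<cdot> \<eta> B"
    by simp
  then show ?thesis
    by (simp add: inverse_right)
qed

lemma S_unit: "S \<cdot> \<eta> B = \<eta> H"
proof -
  have "S \<cdot> \<eta> B = (S \<cdot> T) \<cdot> \<eta> H"
    by (simp add: T_unit)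
  then show ?thesis
    by (simp add: inverse_left)
qed

text \<open>Each side of the first equation is the corresponding side of the second acted upon by
  x1, and this operation is injective because the antipode undoes it.\<close>

lemma brace_compat:
  assumes h: "left_module H M h"
    and [simp]: "\<beta> \<in> Ar C" "Dom C \<beta> = car H \<otimes>\<^sub>o M" "Cod C \<beta> = M"
  shows "conv_act H h M (\<one> (car H)) \<beta> \<cdot> (\<one> (car H) \<otimes> h) = cross_act H h (car H) M (\<mu> Hbar) \<beta> \<longleftrightarrow>
    \<beta> \<cdot> (\<one> (car H) \<otimes> h) = cross_act H h (car H) M lift_action \<beta>" (is "?l = ?r \<longleftrightarrow> ?l' = ?r'")
proof -
  note [simp] = moduleD(1-4)[OF h] conv_act_arr[OF coalg(1) h] cross_act_arr[OF coalg(1) h]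
  let ?A = "conv_act H h (car H \<otimes>\<^sub>o M) (\<one> (car H))"
  let ?A' = "conv_act H h (car H \<otimes>\<^sub>o M) (antipode H)"
  have l: "?l = ?A ?l'"
    by (rule conv_act_precomp[OF coalg(1) h]) (simp_all add: hom_iff)
  \<comment> \<open>The factor absorbed by the action of x1 is the defining formula of
    \<open>\<mu> Hbar\<close>.\<close>
  have r: "?r = ?A ?r'"
    unfolding mu_Hbar by (rule conv_act_cross_act[OF coalg(1) alg(1) h, symmetric]) simp_all
  have "?A' (?A ?l') = ?l'" "?A' (?A ?r') = ?r'"
    by (rule conv_act_cancel[OF coalg(1) alg(1) h]; simp add: hopfD(7,8)[OF hopf(1)])+
  then show ?thesis
    unfolding l r by metis
qed

lemma action_T_compat:
  assumes h: "left_module H M h"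
    and [simp]: "b \<in> Ar C" "Dom C b = car B \<otimes>\<^sub>o M" "Cod C b = M"
    and compat: "b \<cdot> (\<one> (car B) \<otimes> h) = cross_act B h (car H) M \<phi> b"
  defines "\<beta> \<equiv> b \<cdot> (T \<otimes> \<one> M)"
  shows "\<beta> \<cdot> (\<one> (car H) \<otimes> h) = cross_act H h (car H) M lift_action \<beta>"
proof -
  note [simp] = moduleD(1-4)[OF h] cross_act_arr[OF coalg(2) h]
  have "\<beta> \<cdot> (\<one> (car H) \<otimes> h) = (b \<cdot> (\<one> (car B) \<otimes> h)) \<cdot> (T \<otimes> \<one> (car H \<otimes>\<^sub>o M))"
    by (simp add: \<beta>_def interchange)
  also have "\<dots> = cross_act H h (car H) M lift_action \<beta>"
    unfolding compat \<beta>_def by (rule cross_act_comp[OF T_coalg coalg h]) simp_all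
  finally show ?thesis .
qed

lemma action_S_compat:
  assumes h: "left_module H M h"
    and [simp]: "\<beta> \<in> Ar C" "Dom C \<beta> = car H \<otimes>\<^sub>o M" "Cod C \<beta> = M"
    and compat: "\<beta> \<cdot> (\<one> (car H) \<otimes> h) = cross_act H h (car H) M lift_action \<beta>"
  defines "b \<equiv> \<beta> \<cdot> (S \<otimes> \<one> M)"
  shows "b \<cdot> (\<one> (car B) \<otimes> h) = cross_act B h (car H) M \<phi> b"
proof -
  note [simp] = moduleD(1-4)[OF h] cross_act_arr[OF coalg(1) h]
  have "b \<cdot> (\<one> (car B) \<otimes> h) = (\<beta> \<cdot> (\<one> (car H) \<otimes> h)) \<cdot> (S \<otimes> \<one> (car H \<otimes>\<^sub>o M))"
    by (simp add: b_def interchange)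
  also have "\<dots> = cross_act B h (car H) M (lift_action \<cdot> (S \<otimes> \<one> (car H))) b"
    unfolding compat b_def by (rule cross_act_comp[OF S_coalg coalg(2,1) h]) simp_all
  also have "lift_action \<cdot> (S \<otimes> \<one> (car H)) = \<phi>"
    by (simp add: interchange inverse_right)
  finally show ?thesis .
qed

text \<open>The identity and the antipode are convolution inverse in both orders, so the two
  passages between \<beta> and the second brace action are mutually inverse.\<close>

lemma gamma_act:
  assumes h: "left_module H M h"
    and [simp]: "\<beta> \<in> Ar C" "Dom C \<beta> = car H \<otimes>\<^sub>o M" "Cod C \<beta> = M"
  shows "conv_act H h M (antipode H) (conv_act H h M (\<one> (car H)) \<beta>) = \<beta>"
    "conv_act H h M (\<one> (car H)) (conv_act H h M (antipode H) \<beta>) = \<beta>"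
  by (rule conv_act_cancel[OF coalg(1) alg(1) h]; simp add: hopfD(7,8)[OF hopf(1)] moduleD(1)[OF h])+

text \<open>Both \<open>\<Gamma> (x \<circ> y, m)\<close> and \<open>\<Gamma> (x, \<Gamma> (y, m))\<close> become \<open>(x \<circ> y) \<circ> m\<close> when acted upon
  by \<open>x \<circ> y\<close>, that is, after \<open>conv_act\<close> over the coalgebra \<open>H \<otimes> H\<close> with the coalgebra morphism
  \<open>\<mu> Hbar\<close>; the antipode undoes this action.\<close>

lemma gamma_module:
  assumes h: "left_module H M h" and a: "left_module Hbar M a"
    and compat: "a \<cdot> (\<one> (car H) \<otimes> h) =
      cross_act H h (car H) M (\<mu> Hbar) (conv_act H h M (antipode H) a)"
  shows "left_module Hbar M (conv_act H h M (antipode H) a)"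
proof -
  note [simp] = moduleD(1-4)[OF h] moduleD(1-4)[OF a, simplified] conv_act_arr[OF coalg(1) h]
    cross_act_arr[OF coalg(1) h]
  define \<Gamma> where "\<Gamma> = conv_act H h M (antipode H) a"
  have [simp]: "\<Gamma> \<in> Ar C" "Dom C \<Gamma> = car H \<otimes>\<^sub>o M" "Cod C \<Gamma> = M"
    by (simp_all add: \<Gamma>_def)
  have a_eq: "conv_act H h M (\<one> (car H)) \<Gamma> = a"
    unfolding \<Gamma>_def by (rule gamma_act[OF h]) simp_all
  let ?D = "tensor_coalg H H"
  have D: "is_coalgebra ?D"
    by (intro tensor_coalg_coalgebra coalg)
  have [simp]: "car ?D = car H \<otimes>\<^sub>o car H"
    by (simp add: tensor_coalg_def)
  let ?A = "conv_act ?D h M (\<mu> Hbar)"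
  have act_mult: "?A (\<Gamma> \<cdot> (\<mu> Hbar \<otimes> \<one> M)) = a \<cdot> (\<mu> Hbar \<otimes> \<one> M)"
    using conv_act_comp[OF mu_Hbar_coalg D coalg(1) h, of M "\<one> (car H)" \<Gamma>] by (simp add: a_eq)
  \<comment> \<open>Read from right to left, the compatibility condition turns (x1 \<circ> y1)
    \<cdot> \<Gamma>(x2, \<Gamma>(y2, m)) into x \<circ> (y1 \<cdot> \<Gamma>(y2, m)), which is x
    \<circ> (y \<circ> m).\<close>
  have "?A (\<Gamma> \<cdot> (\<one> (car H) \<otimes> \<Gamma>)) =
      (a \<cdot> (\<one> (car H) \<otimes> h)) \<cdot> (\<one> (car H) \<otimes> ((\<one> (car H) \<otimes> \<Gamma>) \<cdot> (\<delta> H \<otimes> \<one> M)))"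
    unfolding compat \<Gamma>_def[symmetric] by (rule cross_act_tensor[OF coalg(1,1) h, symmetric]) simp_all
  also have "\<dots> = a \<cdot> (\<one> (car H) \<otimes> conv_act H h M (\<one> (car H)) \<Gamma>)"
    by (simp add: conv_act_def interchange del: tensor_id_id)
  also have "\<dots> = a \<cdot> (\<mu> Hbar \<otimes> \<one> M)"
    unfolding a_eq using moduleD(6)[OF a] by simp
  finally have act_iter: "?A (\<Gamma> \<cdot> (\<one> (car H) \<otimes> \<Gamma>)) = a \<cdot> (\<mu> Hbar \<otimes> \<one> M)" .
  have cancel: "conv_act ?D h M (antipode H \<cdot> \<mu> Hbar) (?A \<Theta>) = \<Theta>"
    if "\<Theta> \<in> Ar C" "Dom C \<Theta> = car H \<otimes>\<^sub>o car H \<otimes>\<^sub>o M" "Cod C \<Theta> = M" for \<Theta>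
    by (rule conv_act_cancel[OF D alg(1) h])
      (use that in \<open>simp_all add: antipode_comp_conv_inverse[OF hopf(1) mu_Hbar_coalg D]\<close>)
  have "\<Gamma> \<cdot> (\<one> (car H) \<otimes> \<Gamma>) = conv_act ?D h M (antipode H \<cdot> \<mu> Hbar) (a \<cdot> (\<mu> Hbar \<otimes> \<one> M))"
    unfolding act_iter[symmetric] by (rule cancel[symmetric]) simp_all
  also have "\<dots> = \<Gamma> \<cdot> (\<mu> Hbar \<otimes> \<one> M)"
    unfolding act_mult[symmetric] by (rule cancel) simp_all
  finally have "\<Gamma> \<cdot> (\<one> (car H) \<otimes> \<Gamma>) = \<Gamma> \<cdot> (\<mu> Hbar \<otimes> \<one> M)" .
  moreover have "\<Gamma> \<cdot> (\<eta> H \<otimes> \<one> M) = \<one> M"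
  proof -
    have u: "\<delta> H \<cdot> \<eta> H = \<eta> H \<otimes> \<eta> H"
      using hopf(1) by (simp add: is_hopf_algebra_def coalg_morphism_def unit_coalg_def)
    have "\<Gamma> \<cdot> (\<eta> H \<otimes> \<one> M) = h \<cdot> (antipode H \<otimes> a) \<cdot> ((\<delta> H \<cdot> \<eta> H) \<otimes> \<one> M)"
      by (simp add: \<Gamma>_def conv_act_def whisker_right)
    also have "\<dots> = h \<cdot> ((antipode H \<cdot> \<eta> H) \<otimes> (a \<cdot> (\<eta> H \<otimes> \<one> M)))"
      unfolding u by (simp add: interchange)
    also have "\<dots> = \<one> M"
      using moduleD(5)[OF h] moduleD(5)[OF a] by (simp add: antipode_unit[OF hopf(1)])
    finally show ?thesis .
  qed
  ultimately show ?thesis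
    by (simp add: left_module_def hom_iff flip: \<Gamma>_def)
qed

section \<open>Passage between modules over the operator and modules over the brace\<close>

lemma brace_\<Gamma>_eq: "brace_\<Gamma> (associated_brace H B T \<phi>) M a1 a2 = conv_act H a1 M (antipode H) a2"
  by (simp add: brace_\<Gamma>_def conv_act_def associated_brace_def)

lemma brace_module_iff: "brace_module (associated_brace H B T \<phi>) (M, a1, a2) \<longleftrightarrow>
    left_module H M a1 \<and> left_module Hbar M a2 \<and>
    a2 \<cdot> (\<one> (car H) \<otimes> a1) = cross_act H a1 (car H) M (\<mu> Hbar) (conv_act H a1 M (antipode H) a2)"
proof -
  \<comment> \<open>Naming the second component exposes the pair on which the defining equations
    match, without unfolding the updated record.\<close>
  obtain K where "associated_brace H B T \<phi> = (H, K)"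
    by (simp add: associated_brace_def)
  then show ?thesis
    using brace_\<Gamma>_eq[of M a1 a2] by (simp add: cross_act_def)
qed

lemma rb_module_iff: "rb_module H B T \<phi> (M, N, h, b, n, g) \<longleftrightarrow>
    left_module H M h \<and> left_module B M b \<and>
    b \<cdot> (\<one> (car B) \<otimes> h) = cross_act B h (car H) M \<phi> b \<and>
    left_module B N n \<and> g \<in> hom M N \<and>
    n \<cdot> (T \<otimes> g) = g \<cdot> conv_act H h M (\<one> (car H)) (b \<cdot> (T \<otimes> \<one> M))"
  by (simp add: conv_act_def cross_act_def)

text \<open>The module laws for \<open>a\<close> are not computed from its formula. The condition on
  \<gamma> can be solved for \<open>a\<close>, exhibiting it as the action on \<open>N\<close>
  pulled back along \<open>T\<close> and \<gamma>.\<close>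

lemma brace_module_of_rb_module:
  assumes rb: "rb_module H B T \<phi> (M, N, h, b, n, g)" and g: "is_iso C g"
  defines "a \<equiv> conv_act H h M (\<one> (car H)) (b \<cdot> (T \<otimes> \<one> M))"
  shows "brace_module (associated_brace H B T \<phi>) (M, h, a)"
    and "conv_act H h M (antipode H) a = b \<cdot> (T \<otimes> \<one> M)"
proof -
  have h: "left_module H M h" and b: "left_module B M b" and n: "left_module B N n"
    and g1: "g \<in> hom M N"
    and compat: "b \<cdot> (\<one> (car B) \<otimes> h) = cross_act B h (car H) M \<phi> b"
    and na: "n \<cdot> (T \<otimes> g) = g \<cdot> a"
    using rb unfolding rb_module_iff a_def by auto
  note [simp] = moduleD(1-4)[OF h] moduleD(1-4)[OF b] moduleD(1-4)[OF n] conv_act_arr[OF coalg(1) h]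
  obtain g' where g': "g' \<in> hom N M" "g' \<cdot> g = \<one> M" "g \<cdot> g' = \<one> N"
    using g g1 by (auto simp: is_iso_def hom_iff)
  have [simp]: "g \<in> Ar C" "Dom C g = M" "Cod C g = N" "g' \<in> Ar C" "Dom C g' = N" "Cod C g' = M"
    "a \<in> Ar C" "Dom C a = car H \<otimes>\<^sub>o M" "Cod C a = M"
    using g1 g' by (auto simp: hom_iff a_def)
  have "g' \<cdot> n \<cdot> (T \<otimes> g) = (g' \<cdot> g) \<cdot> a"
    unfolding na by simp
  then have "a = g' \<cdot> n \<cdot> (T \<otimes> g)"
    by (simp add: g')
  also have "left_module Hbar M \<dots>"
    by (rule module_pullback[OF n]) (simp_all add: g1 g' T_unit T_mult hom_iff)
  finally have a: "left_module Hbar M a" .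
  show gam: "conv_act H h M (antipode H) a = b \<cdot> (T \<otimes> \<one> M)"
    unfolding a_def by (rule gamma_act[OF h]) simp_all
  have "a \<cdot> (\<one> (car H) \<otimes> h) = cross_act H h (car H) M (\<mu> Hbar) (b \<cdot> (T \<otimes> \<one> M))"
    unfolding a_def
    by (subst brace_compat[OF h]) (use action_T_compat[OF h _ _ _ compat] in simp_all)
  then show "brace_module (associated_brace H B T \<phi>) (M, h, a)"
    unfolding brace_module_iff gam using h a by simp
qed

text \<open>With an identity as \<gamma>, the condition on \<gamma> becomes x \<circ> m = x1 \<cdot>
  \<Gamma>(x2, m). The second claim records that the original brace action is recovered
  exactly.\<close>

lemma rb_module_of_brace_module:
  assumes br: "brace_module (associated_brace H B T \<phi>) (M, h, a)"
  defines "b \<equiv> conv_act H h M (antipode H) a \<cdot> (S \<otimes> \<one> M)"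
  shows "rb_module H B T \<phi> (M, M, h, b, a \<cdot> (S \<otimes> \<one> M), \<one> M)"
    and "conv_act H h M (\<one> (car H)) (b \<cdot> (T \<otimes> \<one> M)) = a"
proof -
  define \<Gamma> where "\<Gamma> = conv_act H h M (antipode H) a"
  have h: "left_module H M h" and a: "left_module Hbar M a"
    and compat: "a \<cdot> (\<one> (car H) \<otimes> h) = cross_act H h (car H) M (\<mu> Hbar) \<Gamma>"
    using br unfolding brace_module_iff \<Gamma>_def by auto
  note [simp] = moduleD(1-4)[OF h] moduleD(1-4)[OF a, simplified] conv_act_arr[OF coalg(1) h]
  have [simp]: "\<Gamma> \<in> Ar C" "Dom C \<Gamma> = car H \<otimes>\<^sub>o M" "Cod C \<Gamma> = M"
    by (simp_all add: \<Gamma>_def)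
  have \<Gamma>: "left_module Hbar M \<Gamma>"
    unfolding \<Gamma>_def by (rule gamma_module[OF h a compat[unfolded \<Gamma>_def]])
  have a_eq: "conv_act H h M (\<one> (car H)) \<Gamma> = a"
    unfolding \<Gamma>_def by (rule gamma_act[OF h]) simp_all
  have pull: "left_module B M (x \<cdot> (S \<otimes> \<one> M))" if x: "left_module Hbar M x" for x
    using module_pullback[OF x, of B S "\<one> M" M "\<one> M"] moduleD(1-4)[OF x]
    by (simp add: S_unit S_mult hom_iff)
  have b_T: "b \<cdot> (T \<otimes> \<one> M) = \<Gamma>"
    by (simp add: b_def interchange inverse_left flip: \<Gamma>_def)
  show ba: "conv_act H h M (\<one> (car H)) (b \<cdot> (T \<otimes> \<one> M)) = a"
    unfolding b_T by (rule a_eq)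
  have "\<Gamma> \<cdot> (\<one> (car H) \<otimes> h) = cross_act H h (car H) M lift_action \<Gamma>"
    using brace_compat[OF h, of \<Gamma>] compat by (simp add: a_eq)
  then have "b \<cdot> (\<one> (car B) \<otimes> h) = cross_act B h (car H) M \<phi> b"
    unfolding b_def \<Gamma>_def[symmetric] by (intro action_S_compat[OF h]) simp_all
  then show "rb_module H B T \<phi> (M, M, h, b, a \<cdot> (S \<otimes> \<one> M), \<one> M)"
    unfolding rb_module_iff ba
    using h pull[OF a] pull[OF \<Gamma>] by (simp add: b_def hom_iff interchange inverse_left flip: \<Gamma>_def)
qed

end

section \<open>The module categories\<close>

lemma full_subcategory_simps [simp]:
  "Ob (full_subcategory D P) = {A \<in> Ob D. P A}"
  "Ar (full_subcategory D P) = {f \<in> Ar D. P (Dom D f) \<and> P (Cod D f)}"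
  "Dom (full_subcategory D P) = Dom D" "Cod (full_subcategory D P) = Cod D"
  "Id (full_subcategory D P) = Id D" "Comp (full_subcategory D P) = Comp D"
  by (simp_all add: full_subcategory_def)

lemma category_full_subcategory:
  assumes "category D"
  shows "category (full_subcategory D P)"
proof -
  interpret category D by fact
  show ?thesis
    by unfold_locales (auto simp: hom_iff homset_def dom_ob cod_ob)
qed

text \<open>Common pattern of both module categories. \<open>Comp\<close> is total and does not
  compare the middle objects; the category axioms only concern arrows that match, through
  \<open>homset\<close>.\<close>

lemma category_triples:
  fixes P :: "'a \<Rightarrow> bool" and R :: "'a \<Rightarrow> 'a \<Rightarrow> 'u \<Rightarrow> bool"
  assumes "\<And>X. P X \<Longrightarrow> R X X (e X)"
    and "\<And>X Y Z u v. P X \<Longrightarrow> P Y \<Longrightarrow> P Z \<Longrightarrow> R X Y u \<Longrightarrow> R Y Z v \<Longrightarrow> R X Z (m v u)"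
    and "\<And>W X Y Z u v w. P W \<Longrightarrow> P X \<Longrightarrow> P Y \<Longrightarrow> P Z \<Longrightarrow> R W X u \<Longrightarrow> R X Y v \<Longrightarrow> R Y Z w \<Longrightarrow>
      m (m w v) u = m w (m v u)"
    and "\<And>X Y u. P X \<Longrightarrow> P Y \<Longrightarrow> R X Y u \<Longrightarrow> m (e Y) u = u"
    and "\<And>X Y u. P X \<Longrightarrow> P Y \<Longrightarrow> R X Y u \<Longrightarrow> m u (e X) = u"
  shows "category \<lparr>Ob = {X. P X}, Ar = {(X, Y, u). P X \<and> P Y \<and> R X Y u},
    Dom = (\<lambda>(X, Y, u). X), Cod = (\<lambda>(X, Y, u). Y), Id = (\<lambda>X. (X, X, e X)),
    Comp = (\<lambda>(Y', Z, v) (X, Y, u). (X, Z, m v u))\<rparr>"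
  by unfold_locales (auto simp: homset_def intro: assms)

context braided_cat
begin

section \<open>Category axioms for the module categories and description of their arrows\<close>

lemma module_morphism_id:
  assumes "left_module X M a" "car X \<in> Ob C"
  shows "module_morphism X M a M a (\<one> M)"
  using assms moduleD[OF assms(1)] by (simp add: module_morphism_def hom_iff)

lemma module_morphism_comp:
  assumes a: "left_module X M a" and b: "left_module X P b" and c: "left_module X Q c"
    and [simp]: "car X \<in> Ob C"
    and r: "module_morphism X M a P b r" and s: "module_morphism X P b Q c s"
  shows "module_morphism X M a Q c (s \<cdot> r)"
proof -
  note [simp] = moduleD(1-4)[OF a] moduleD(1-4)[OF b] moduleD(1-4)[OF c]
  have [simp]: "r \<in> Ar C" "Dom C r = M" "Cod C r = P" "s \<in> Ar C" "Dom C s = P" "Cod C s = Q"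
    and eqs: "r \<cdot> a = b \<cdot> (\<one> (car X) \<otimes> r)" "s \<cdot> b = c \<cdot> (\<one> (car X) \<otimes> s)"
    using r s by (auto simp: module_morphism_def hom_iff)
  have "(s \<cdot> r) \<cdot> a = c \<cdot> (\<one> (car X) \<otimes> (s \<cdot> r))"
    by (simp add: eqs(1) comp_reduce[OF eqs(2)] interchange)
  then show ?thesis
    by (simp add: module_morphism_def hom_iff)
qed

lemma module_morphism_inverse:
  assumes a: "left_module X M a" and b: "left_module X P b" and [simp]: "car X \<in> Ob C"
    and r: "module_morphism X M a P b r" and s: "s \<in> hom P M" "s \<cdot> r = \<one> M" "r \<cdot> s = \<one> P"
  shows "module_morphism X P b M a s"
proof -
  note [simp] = moduleD(1-4)[OF a] moduleD(1-4)[OF b]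
  have [simp]: "r \<in> Ar C" "Dom C r = M" "Cod C r = P" "s \<in> Ar C" "Dom C s = P" "Cod C s = M"
    and eq: "r \<cdot> a = b \<cdot> (\<one> (car X) \<otimes> r)"
    using r s by (auto simp: module_morphism_def hom_iff)
  have "s \<cdot> b = s \<cdot> (b \<cdot> (\<one> (car X) \<otimes> r)) \<cdot> (\<one> (car X) \<otimes> s)"
    by (simp add: interchange s)
  also have "\<dots> = (s \<cdot> r) \<cdot> a \<cdot> (\<one> (car X) \<otimes> s)"
    unfolding eq[symmetric] by simp
  also have "\<dots> = a \<cdot> (\<one> (car X) \<otimes> s)"
    by (simp add: s)
  finally show ?thesis
    using s by (simp add: module_morphism_def)
qed

lemma category_brace_mod_cat:
  assumes "car H1 \<in> Ob C" "car H2 \<in> Ob C"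
  shows "category (brace_mod_cat (H1, H2))"
proof -
  have id: "brace_module_morphism (H1, H2) X X (\<one> (fst X))" if "brace_module (H1, H2) X" for X
    using that assms by (cases X) (auto intro: module_morphism_id)
  have comp: "brace_module_morphism (H1, H2) X Z (s \<cdot> r)"
    if "brace_module (H1, H2) X" "brace_module (H1, H2) Y" "brace_module (H1, H2) Z"
      "brace_module_morphism (H1, H2) X Y r" "brace_module_morphism (H1, H2) Y Z s" for X Y Z r s
    using that assms by (cases X; cases Y; cases Z) (auto intro: module_morphism_comp)
  have hom: "r \<in> hom (fst X) (fst Y)" if "brace_module_morphism (H1, H2) X Y r" for X Y r
    using that by (cases X; cases Y) (auto simp: module_morphism_def)
  show ?thesis
    unfolding brace_mod_cat_def
    \<comment> \<open>The middle object of \<open>comp\<close> occurs only in its premises; solving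
      the three module premises by assumption instantiates it before the search.\<close>
    by (rule category_triples; (erule (2) comp)?)
      (blast intro: id comp dest: hom intro: comp_assoc comp_id_left comp_id_right)+
qed

lemma category_rb_mod_cat:
  assumes [simp]: "car H \<in> Ob C" "car B \<in> Ob C"
  shows "category (rb_mod_cat H B T \<phi>)"
proof -
  have id: "rb_module_morphism H B X X (case X of (M, N, _) \<Rightarrow> (\<one> M, \<one> N))"
    if "rb_module H B T \<phi> X" for X
    using that by (cases X) (auto intro!: module_morphism_id simp: hom_iff)
  have hom: "r \<in> hom (fst X) (fst Y) \<and> s \<in> hom (fst (snd X)) (fst (snd Y))"
    if "rb_module_morphism H B X Y (r, s)" for X Y r s
    using that by (cases X; cases Y) (auto simp: module_morphism_def)
  have comp: "rb_module_morphism H B X Z (r' \<cdot> r, s' \<cdot> s)"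
    if X: "rb_module H B T \<phi> X" and Y: "rb_module H B T \<phi> Y" and Z: "rb_module H B T \<phi> Z"
      and f: "rb_module_morphism H B X Y (r, s)" and g: "rb_module_morphism H B Y Z (r', s')"
    for X Y Z r s r' s'
  proof -
    obtain M N h b n \<gamma> where X': "X = (M, N, h, b, n, \<gamma>)" by (cases X)
    obtain P Q k c p \<theta> where Y': "Y = (P, Q, k, c, p, \<theta>)" by (cases Y)
    obtain U V l d q \<zeta> where Z': "Z = (U, V, l, d, q, \<zeta>)" by (cases Z)
    have [simp]: "\<gamma> \<in> Ar C" "Dom C \<gamma> = M" "Cod C \<gamma> = N" "\<theta> \<in> Ar C" "Dom C \<theta> = P" "Cod C \<theta> = Q"
      "\<zeta> \<in> Ar C" "Dom C \<zeta> = U" "Cod C \<zeta> = V"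
      using X Y Z by (auto simp: X' Y' Z' hom_iff)
    have [simp]: "r \<in> Ar C" "Dom C r = M" "Cod C r = P" "s \<in> Ar C" "Dom C s = N" "Cod C s = Q"
      "r' \<in> Ar C" "Dom C r' = P" "Cod C r' = U" "s' \<in> Ar C" "Dom C s' = Q" "Cod C s' = V"
      using hom[OF f] hom[OF g] by (auto simp: X' Y' Z' hom_iff)
    have eqs: "s \<cdot> \<gamma> = \<theta> \<cdot> r" "s' \<cdot> \<theta> = \<zeta> \<cdot> r'"
      using f g by (auto simp: X' Y' Z')
    have "(s' \<cdot> s) \<cdot> \<gamma> = \<zeta> \<cdot> (r' \<cdot> r)"
      by (simp add: eqs(1) comp_reduce[OF eqs(2)])
    then show ?thesis
      using X Y Z f g by (auto simp: X' Y' Z' intro: module_morphism_comp)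
  qed
  \<comment> \<open>Written with projections instead of pair patterns, the composition takes one
    variable per underlying pair and fits \<open>category_triples\<close>.\<close>
  have pairs: "rb_mod_cat H B T \<phi> = \<lparr>Ob = {X. rb_module H B T \<phi> X},
    Ar = {(X, Y, u). rb_module H B T \<phi> X \<and> rb_module H B T \<phi> Y \<and> rb_module_morphism H B X Y u},
    Dom = (\<lambda>(X, Y, u). X), Cod = (\<lambda>(X, Y, u). Y),
    Id = (\<lambda>X. (X, X, case X of (M, N, _) \<Rightarrow> (\<one> M, \<one> N))),
    Comp = (\<lambda>(Y', Z, v) (X, Y, u). (X, Z, (fst v \<cdot> fst u, snd v \<cdot> snd u)))\<rparr>"
    by (simp add: rb_mod_cat_def fun_eq_iff)
  have hom': "fst u \<in> hom (fst X) (fst Y)" "snd u \<in> hom (fst (snd X)) (fst (snd Y))"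
    if "rb_module_morphism H B X Y u" for X Y u
    using hom[of X Y "fst u" "snd u"] that by auto
  show ?thesis
    unfolding pairs
  proof (rule category_triples)
    show "rb_module_morphism H B X Z (fst v \<cdot> fst u, snd v \<cdot> snd u)"
      if "rb_module H B T \<phi> X" "rb_module H B T \<phi> Y" "rb_module H B T \<phi> Z"
        "rb_module_morphism H B X Y u" "rb_module_morphism H B Y Z v" for X Y Z u v
      using comp[of X Y Z "fst u" "snd u" "fst v" "snd v"] that by simp
    show "(fst (case Y of (M, N, _) \<Rightarrow> (\<one> M, \<one> N)) \<cdot> fst u,
        snd (case Y of (M, N, _) \<Rightarrow> (\<one> M, \<one> N)) \<cdot> snd u) = u"
      if "rb_module_morphism H B X Y u" for X Y u
      using hom'[OF that] by (cases u; cases Y) (auto intro: comp_id_left)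
    show "(fst u \<cdot> fst (case X of (M, N, _) \<Rightarrow> (\<one> M, \<one> N)),
        snd u \<cdot> snd (case X of (M, N, _) \<Rightarrow> (\<one> M, \<one> N))) = u"
      if "rb_module_morphism H B X Y u" for X Y u
      using hom'[OF that] by (cases u; cases X) (auto intro: comp_id_right)
  qed (use id in \<open>auto intro: comp_assoc hom'\<close>)
qed

lemma is_iso_inverse:
  assumes "is_iso C g" "g \<in> hom M N"
  obtains g' where "g' \<in> hom N M" "g' \<cdot> g = \<one> M" "g \<cdot> g' = \<one> N"
  using assms by (auto simp: is_iso_def hom_iff)

lemma is_iso_id: "A \<in> Ob C \<Longrightarrow> is_iso C (\<one> A)"
  unfolding is_iso_def by (auto simp: hom_iff intro!: bexI[of _ "\<one> A"])

lemma hom_brace_mod_cat: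
  "f \<in> hom\<^bsub>brace_mod_cat K\<^esub> X Y \<longleftrightarrow> (\<exists>r. f = (X, Y, r) \<and> brace_module K X \<and> brace_module K Y \<and>
    brace_module_morphism K X Y r)"
  by (auto simp: homset_def brace_mod_cat_def)

lemma Ob_brace_mod_cat: "X \<in> Ob (brace_mod_cat K) \<longleftrightarrow> brace_module K X"
  by (simp add: brace_mod_cat_def)

lemma Id_brace_mod_cat: "\<one>\<^bsub>brace_mod_cat K\<^esub> X = (X, X, \<one> (fst X))"
  by (simp add: brace_mod_cat_def)

lemma Comp_brace_mod_cat: "(Y', Z, r') \<cdot>\<^bsub>brace_mod_cat K\<^esub> (X, Y, r) = (X, Z, r' \<cdot> r)"
  by (simp add: brace_mod_cat_def)

definition rb_iso_module ::
    "('o, 'm) hopf_data \<Rightarrow> ('o, 'm) hopf_data \<Rightarrow> 'm \<Rightarrow> 'm \<Rightarrow> 'o \<times> 'o \<times> 'm \<times> 'm \<times> 'm \<times> 'm \<Rightarrow> bool"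
  where "rb_iso_module H B T \<phi> X \<longleftrightarrow> rb_module H B T \<phi> X \<and> (case X of (M, N, h, b, n, g) \<Rightarrow> is_iso C g)"

lemma hom_rb_mod_iso_cat:
  "f \<in> hom\<^bsub>rb_mod_iso_cat H B T \<phi>\<^esub> X Y \<longleftrightarrow> (\<exists>r s. f = (X, Y, (r, s)) \<and>
    rb_iso_module H B T \<phi> X \<and> rb_iso_module H B T \<phi> Y \<and> rb_module_morphism H B X Y (r, s))"
  by (auto simp: homset_def rb_mod_iso_cat_def rb_mod_cat_def rb_iso_module_def)

lemma Ob_rb_mod_iso_cat: "X \<in> Ob (rb_mod_iso_cat H B T \<phi>) \<longleftrightarrow> rb_iso_module H B T \<phi> X"
  by (auto simp: rb_mod_iso_cat_def rb_mod_cat_def rb_iso_module_def)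

lemma Id_rb_mod_iso_cat:
  "\<one>\<^bsub>rb_mod_iso_cat H B T \<phi>\<^esub> X = (X, X, case X of (M, N, _) \<Rightarrow> (\<one> M, \<one> N))"
  by (simp add: rb_mod_iso_cat_def rb_mod_cat_def)

lemma Comp_rb_mod_iso_cat:
  "(Y', Z, (r', s')) \<cdot>\<^bsub>rb_mod_iso_cat H B T \<phi>\<^esub> (X, Y, (r, s)) = (X, Z, (r' \<cdot> r, s' \<cdot> s))"
  by (simp add: rb_mod_iso_cat_def rb_mod_cat_def)

lemmas brace_mod_cat_iffs = hom_brace_mod_cat Ob_brace_mod_cat Id_brace_mod_cat Comp_brace_mod_cat

lemmas rb_mod_iso_cat_iffs =
  hom_rb_mod_iso_cat Ob_rb_mod_iso_cat Id_rb_mod_iso_cat Comp_rb_mod_iso_cat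

text \<open>Applied with \<open>f\<close> the identity and with \<open>f\<close> the antipode, this
  makes both passages between actions functorial without changing the underlying morphism.\<close>

lemma conv_act_morphism:
  assumes D: "is_coalgebra D" and h: "left_module X M h" and k: "left_module X P k"
    and r: "module_morphism X M h P k r" and [simp]: "car X \<in> Ob C"
    and [simp]: "f \<in> Ar C" "Dom C f = car D" "Cod C f = car X"
    and \<Theta> [simp]: "\<Theta> \<in> Ar C" "Dom C \<Theta> = car D \<otimes>\<^sub>o M" "Cod C \<Theta> = M"
    and \<Theta>' [simp]: "\<Theta>' \<in> Ar C" "Dom C \<Theta>' = car D \<otimes>\<^sub>o P" "Cod C \<Theta>' = P"
    and eq: "r \<cdot> \<Theta> = \<Theta>' \<cdot> (\<one> (car D) \<otimes> r)"
  shows "r \<cdot> conv_act D h M f \<Theta> = conv_act D k P f \<Theta>' \<cdot> (\<one> (car D) \<otimes> r)"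
proof -
  have r': "r \<in> hom M P" "r \<cdot> h = k \<cdot> (\<one> (car X) \<otimes> r)"
    using r by (simp_all add: module_morphism_def)
  note [simp] = moduleD(1)[OF h] moduleD(1)[OF k]
  have "r \<cdot> conv_act D h M f \<Theta> = conv_act D k M f (r \<cdot> \<Theta>)"
    by (rule conv_act_postcomp[OF D h k r']) simp_all
  also have "\<dots> = conv_act D k P f \<Theta>' \<cdot> (\<one> (car D) \<otimes> r)"
    unfolding eq by (rule conv_act_precomp[OF D k r'(1), symmetric]) simp_all
  finally show ?thesis .
qed

lemma restrict_morphism:
  assumes "r \<in> hom M P" "x \<in> hom (D \<otimes>\<^sub>o M) M" "y \<in> hom (D \<otimes>\<^sub>o P) P" "k \<in> hom E D"
    and eq: "r \<cdot> x = y \<cdot> (\<one> D \<otimes> r)"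
  shows "r \<cdot> x \<cdot> (k \<otimes> \<one> M) = (y \<cdot> (k \<otimes> \<one> P)) \<cdot> (\<one> E \<otimes> r)"
proof -
  have [simp]: "M \<in> Ob C" "P \<in> Ob C" "D \<in> Ob C" "E \<in> Ob C"
    using assms(1,4) ob_of_arr by auto
  show ?thesis
    using assms(1-4) by (simp add: hom_iff comp_reduce[OF eq] interchange)
qed

end

section \<open>The two functors and their natural isomorphisms\<close>

context rota_baxter_iso
begin

fun brace_of :: "'o \<times> 'o \<times> 'm \<times> 'm \<times> 'm \<times> 'm \<Rightarrow> 'o \<times> 'm \<times> 'm"
  where "brace_of (M, N, h, b, n, g) = (M, h, conv_act H h M (\<one> (car H)) (b \<cdot> (T \<otimes> \<one> M)))"

fun rb_of :: "'o \<times> 'm \<times> 'm \<Rightarrow> 'o \<times> 'o \<times> 'm \<times> 'm \<times> 'm \<times> 'm"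
  where "rb_of (M, h, a) =
    (M, M, h, conv_act H h M (antipode H) a \<cdot> (S \<otimes> \<one> M), a \<cdot> (S \<otimes> \<one> M), \<one> M)"

abbreviation "brace \<equiv> associated_brace H B T \<phi>"

abbreviation "iso_module \<equiv> rb_iso_module H B T \<phi>"

lemma brace_of_module: "iso_module X \<Longrightarrow> brace_module brace (brace_of X)"
  by (cases X) (auto simp: rb_iso_module_def simp del: rb_module.simps intro: brace_module_of_rb_module(1))

lemma rb_of_module: "brace_module brace X \<Longrightarrow> iso_module (rb_of X)"
proof (cases X)
  case (fields M h a)
  assume "brace_module brace X"
  then have "brace_module brace (M, h, a)"
    by (simp only: fields)
  then have "rb_module H B T \<phi> (rb_of (M, h, a))" and "M \<in> Ob C"
    unfolding rb_of.simps brace_module_iff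
    using rb_module_of_brace_module(1) by (auto dest: moduleD(1) simp: brace_module_iff)
  then show ?thesis
    by (simp add: rb_iso_module_def fields is_iso_id del: rb_module.simps)
qed

lemma brace_of_rb_of: "brace_module brace X \<Longrightarrow> brace_of (rb_of X) = X"
  using rb_module_of_brace_module(2) by (cases X) simp

lemma brace_morphism_iff: "brace_module_morphism brace (M, a1, a2) (P, b1, b2) r \<longleftrightarrow>
    module_morphism H M a1 P b1 r \<and> module_morphism Hbar M a2 P b2 r"
proof -
  obtain K where "brace = (H, K)"
    by (simp add: associated_brace_def)
  then show ?thesis
    by simp
qed

lemma brace_of_morphism:
  assumes X: "iso_module X" and Y: "iso_module Y" and f: "rb_module_morphism H B X Y (r, s)"
  shows "brace_module_morphism brace (brace_of X) (brace_of Y) r"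
proof -
  obtain M N h b n g where X': "X = (M, N, h, b, n, g)" by (cases X)
  obtain P Q h' b' n' g' where Y': "Y = (P, Q, h', b', n', g')" by (cases Y)
  have h: "left_module H M h" and b: "left_module B M b" and h': "left_module H P h'" and b': "left_module B P b'"
    and r: "module_morphism H M h P h' r" and rb: "module_morphism B M b P b' r"
    using X Y f by (auto simp: X' Y' rb_iso_module_def)
  note [simp] = moduleD(1-4)[OF h] moduleD(1-4)[OF b] moduleD(1-4)[OF h'] moduleD(1-4)[OF b']
  have "r \<cdot> b \<cdot> (T \<otimes> \<one> M) = (b' \<cdot> (T \<otimes> \<one> P)) \<cdot> (\<one> (car H) \<otimes> r)"
    by (rule restrict_morphism[where D = "car B"]) (use rb in \<open>simp_all add: hom_iff module_morphism_def\<close>)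
  then have "r \<cdot> conv_act H h M (\<one> (car H)) (b \<cdot> (T \<otimes> \<one> M)) =
      conv_act H h' P (\<one> (car H)) (b' \<cdot> (T \<otimes> \<one> P)) \<cdot> (\<one> (car H) \<otimes> r)"
    by (intro conv_act_morphism[OF coalg(1) h h' r]) simp_all
  then show ?thesis
    using r by (simp add: X' Y' brace_morphism_iff module_morphism_def)
qed

lemma rb_of_morphism:
  assumes X: "brace_module brace X" and Y: "brace_module brace Y" and f: "brace_module_morphism brace X Y r"
  shows "rb_module_morphism H B (rb_of X) (rb_of Y) (r, r)"
proof -
  obtain M h a where X': "X = (M, h, a)" by (cases X)
  obtain P k c where Y': "Y = (P, k, c)" by (cases Y)
  have h: "left_module H M h" and a: "left_module Hbar M a" and k: "left_module H P k" and c: "left_module Hbar P c"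
    and r: "module_morphism H M h P k r" and ra: "module_morphism Hbar M a P c r"
    using X Y f unfolding X' Y' brace_module_iff brace_morphism_iff by auto
  note [simp] = moduleD(1-4)[OF h] moduleD(1-4)[OF a, simplified] moduleD(1-4)[OF k] moduleD(1-4)[OF c, simplified]
    conv_act_arr[OF coalg(1) h] conv_act_arr[OF coalg(1) k]
  have r': "r \<in> hom M P"
    using r by (simp add: module_morphism_def)
  then have [simp]: "r \<in> Ar C" "Dom C r = M" "Cod C r = P"
    by (auto simp: hom_iff)
  have ra': "r \<cdot> a = c \<cdot> (\<one> (car H) \<otimes> r)"
    using ra by (simp add: module_morphism_def)
  have "r \<cdot> conv_act H h M (antipode H) a = conv_act H k P (antipode H) c \<cdot> (\<one> (car H) \<otimes> r)"
    by (rule conv_act_morphism[OF coalg(1) h k r]) (simp_all add: ra')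
  then have "r \<cdot> conv_act H h M (antipode H) a \<cdot> (S \<otimes> \<one> M) =
      (conv_act H k P (antipode H) c \<cdot> (S \<otimes> \<one> P)) \<cdot> (\<one> (car B) \<otimes> r)"
    by (intro restrict_morphism[where D = "car H"]) (simp_all add: hom_iff)
  moreover have "r \<cdot> a \<cdot> (S \<otimes> \<one> M) = (c \<cdot> (S \<otimes> \<one> P)) \<cdot> (\<one> (car B) \<otimes> r)"
    by (rule restrict_morphism[where D = "car H"]) (simp_all add: hom_iff ra')
  ultimately show ?thesis
    using r r' by (simp add: X' Y' module_morphism_def)
qed

text \<open>The round trip returns both actions on \<open>M\<close> unchanged and replaces only
  \<open>N\<close> by \<open>M\<close>. That \<open>g\<close> is linear over \<open>B\<close> for
  the replaced action is the condition on \<gamma> composed with the inverse of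
  \<open>T\<close>.\<close>

lemma rb_of_brace_of:
  assumes X: "iso_module (M, N, h, b, n, g)"
  defines "X' \<equiv> rb_of (brace_of (M, N, h, b, n, g))"
  shows "rb_module_morphism H B X' (M, N, h, b, n, g) (\<one> M, g)"
    and "g' \<in> hom N M \<Longrightarrow> g' \<cdot> g = \<one> M \<Longrightarrow> g \<cdot> g' = \<one> N \<Longrightarrow>
      rb_module_morphism H B (M, N, h, b, n, g) X' (\<one> M, g')"
proof -
  define a where "a = conv_act H h M (\<one> (car H)) (b \<cdot> (T \<otimes> \<one> M))"
  have rb: "rb_module H B T \<phi> (M, N, h, b, n, g)" and giso: "is_iso C g"
    using X by (auto simp: rb_iso_module_def)
  have h: "left_module H M h" and b: "left_module B M b" and n: "left_module B N n" and g: "g \<in> hom M N"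
    and na: "n \<cdot> (T \<otimes> g) = g \<cdot> a"
    using rb unfolding rb_module_iff a_def by auto
  note [simp] = moduleD(1-4)[OF h] moduleD(1-4)[OF b] moduleD(1-4)[OF n] conv_act_arr[OF coalg(1) h]
  have [simp]: "g \<in> Ar C" "Dom C g = M" "Cod C g = N"
    "a \<in> Ar C" "Dom C a = car H \<otimes>\<^sub>o M" "Cod C a = M"
    using g by (auto simp: hom_iff a_def)
  have "conv_act H h M (antipode H) a \<cdot> (S \<otimes> \<one> M) = b \<cdot> ((T \<cdot> S) \<otimes> \<one> M)"
    using brace_module_of_rb_module(2)[OF rb giso] by (simp add: interchange flip: a_def)
  then have X'_eq: "X' = (M, M, h, b, a \<cdot> (S \<otimes> \<one> M), \<one> M)"
    by (simp add: X'_def inverse_right flip: a_def)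
  have "iso_module X'"
    unfolding X'_def by (intro rb_of_module brace_of_module X)
  then have n': "left_module B M (a \<cdot> (S \<otimes> \<one> M))"
    by (simp add: X'_eq rb_iso_module_def)
  have "g \<cdot> a \<cdot> (S \<otimes> \<one> M) = (n \<cdot> (T \<otimes> g)) \<cdot> (S \<otimes> \<one> M)"
    unfolding na by simp
  also have "\<dots> = n \<cdot> (\<one> (car B) \<otimes> g)"
    by (simp add: interchange inverse_right)
  finally have gm: "module_morphism B M (a \<cdot> (S \<otimes> \<one> M)) N n g"
    using g by (simp add: module_morphism_def)
  show "rb_module_morphism H B X' (M, N, h, b, n, g) (\<one> M, g)"
    using gm by (simp add: X'_eq module_morphism_id[OF h] module_morphism_id[OF b])
  assume g': "g' \<in> hom N M" "g' \<cdot> g = \<one> M" "g \<cdot> g' = \<one> N"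
  then show "rb_module_morphism H B (M, N, h, b, n, g) X' (\<one> M, g')"
    using module_morphism_inverse[OF n' n _ gm g']
    by (simp add: X'_eq module_morphism_id[OF h] module_morphism_id[OF b])
qed

abbreviation "RB \<equiv> rb_mod_iso_cat H B T \<phi>"

abbreviation "BR \<equiv> brace_mod_cat brace"

lemma category_RB: "category RB"
  unfolding rb_mod_iso_cat_def by (intro category_full_subcategory category_rb_mod_cat) simp_all

lemma category_BR: "category BR"
proof -
  obtain K where K: "brace = (H, K)" "car K = car H"
    by (simp add: associated_brace_def)
  show ?thesis
    unfolding K(1) by (rule category_brace_mod_cat) (simp_all add: K(2))
qed

text \<open>Dropping \<open>s\<close> loses nothing between objects with invertible \<gamma>: the
  commuting square determines it as \<theta> r \<gamma>^{-1}.\<close>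

definition brace_of_arr where
  "brace_of_arr = (\<lambda>(X, Y, (r, s)). (brace_of X, brace_of Y, r))"

definition rb_of_arr where
  "rb_of_arr = (\<lambda>(X, Y, r). (rb_of X, rb_of Y, (r, r)))"

lemma brace_of_functor: "is_functor RB BR brace_of brace_of_arr"
proof -
  have "brace_of_arr (\<one>\<^bsub>RB\<^esub> X) = \<one>\<^bsub>BR\<^esub> (brace_of X)" for X
    by (cases X) (simp add: brace_of_arr_def Id_rb_mod_iso_cat Id_brace_mod_cat)
  then show ?thesis
    unfolding is_functor_def
    by (auto simp: rb_mod_iso_cat_iffs(1,2,4) brace_mod_cat_iffs(1,2,4) brace_of_arr_def
        brace_of_module brace_of_morphism simp del: rb_module_morphism.simps brace_of.simps)
qed

lemma rb_of_functor: "is_functor BR RB rb_of rb_of_arr"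
proof -
  have "rb_of_arr (\<one>\<^bsub>BR\<^esub> X) = \<one>\<^bsub>RB\<^esub> (rb_of X)" for X
    by (cases X) (simp add: rb_of_arr_def Id_rb_mod_iso_cat Id_brace_mod_cat)
  then show ?thesis
    unfolding is_functor_def
    by (auto simp: rb_mod_iso_cat_iffs(1,2,4) brace_mod_cat_iffs(1,2,4) rb_of_arr_def
        rb_of_module rb_of_morphism simp del: rb_module_morphism.simps rb_of.simps)
qed

text \<open>The source has an identity in place of \<gamma>, so once the first component is an
  identity the commuting square forces the second to be \<open>g\<close>.\<close>

definition unit_arr where
  "unit_arr X = (rb_of (brace_of X), X, case X of (M, N, h, b, n, g) \<Rightarrow> (\<one> M, g))"

lemma unit_natural_iso:
  "is_natural_iso RB RB (rb_of \<circ> brace_of) (rb_of_arr \<circ> brace_of_arr) id id unit_arr"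
proof -
  have hom: "unit_arr X \<in> hom\<^bsub>RB\<^esub> (rb_of (brace_of X)) X" if "iso_module X" for X
    using that rb_of_brace_of(1)
    by (cases X) (auto simp: rb_mod_iso_cat_iffs unit_arr_def intro: rb_of_module brace_of_module
        simp del: rb_module_morphism.simps brace_of.simps rb_of.simps)
  have iso: "is_iso RB (unit_arr X)" if X: "iso_module X" for X
  proof -
    obtain M N h b n g where X': "X = (M, N, h, b, n, g)" by (cases X)
    have "is_iso C g" "g \<in> hom M N" "M \<in> Ob C"
      using X by (auto simp: X' rb_iso_module_def dest: moduleD(1))
    then obtain g' where g': "g' \<in> hom N M" "g' \<cdot> g = \<one> M" "g \<cdot> g' = \<one> N"
      using is_iso_inverse by blast
    let ?i = "(X, rb_of (brace_of X), (\<one> M, g'))"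
    have u: "unit_arr X \<in> Ar RB" "Dom RB (unit_arr X) = rb_of (brace_of X)" "Cod RB (unit_arr X) = X"
      using hom[OF X] by (auto simp: homset_def)
    have "?i \<in> hom\<^bsub>RB\<^esub> X (rb_of (brace_of X))"
      using rb_of_brace_of(2)[OF X[unfolded X'] g'] X rb_of_module[OF brace_of_module[OF X]]
      by (auto simp: hom_rb_mod_iso_cat X' simp del: rb_module_morphism.simps brace_of.simps rb_of.simps)
    moreover have "?i \<cdot>\<^bsub>RB\<^esub> unit_arr X = \<one>\<^bsub>RB\<^esub> (rb_of (brace_of X))"
      "unit_arr X \<cdot>\<^bsub>RB\<^esub> ?i = \<one>\<^bsub>RB\<^esub> X"
      using \<open>M \<in> Ob C\<close> g' by (simp_all add: unit_arr_def X' Comp_rb_mod_iso_cat Id_rb_mod_iso_cat)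
    ultimately show ?thesis
      unfolding is_iso_def u using u(1) by blast
  qed
  \<comment> \<open>In the second component, naturality is the commuting square of the morphism (r,
    s).\<close>
  have nat: "unit_arr Y \<cdot>\<^bsub>RB\<^esub> rb_of_arr (brace_of_arr f) = f \<cdot>\<^bsub>RB\<^esub> unit_arr X"
    if f: "f \<in> hom\<^bsub>RB\<^esub> X Y" for f X Y
  proof -
    obtain r s where f': "f = (X, Y, (r, s))" "rb_module_morphism H B X Y (r, s)"
      using f by (auto simp: hom_rb_mod_iso_cat)
    then show ?thesis
      by (cases X; cases Y) (auto simp: unit_arr_def rb_of_arr_def brace_of_arr_def Comp_rb_mod_iso_cat
          module_morphism_def hom_iff)
  qed
  show ?thesis
    unfolding is_natural_iso_def using hom iso nat by (auto simp: Ob_rb_mod_iso_cat)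
qed

text \<open>The round trip on brace modules is the identity on objects and arrows, not merely up to
  isomorphism, so identities serve as components.\<close>

lemma counit_natural_iso:
  "is_natural_iso BR BR (brace_of \<circ> rb_of) (brace_of_arr \<circ> rb_of_arr) id id (Id BR)"
proof -
  interpret BR: category BR
    by (rule category_BR)
  have iso: "is_iso BR (Id BR X)" if "X \<in> Ob BR" for X
    unfolding is_iso_def using that
    by (metis BR.comp_id_left BR.hom_iff BR.id_hom)
  have "brace_of_arr (rb_of_arr f) = f" if "f \<in> hom\<^bsub>BR\<^esub> X Y" for f X Y
    using that by (auto simp: hom_brace_mod_cat brace_of_arr_def rb_of_arr_def brace_of_rb_of)
  then show ?thesis
    unfolding is_natural_iso_def using iso BR.id_hom
    by (auto simp: Ob_brace_mod_cat brace_of_rb_of BR.comp_id_left BR.comp_id_right)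
qed

lemma equivalent: "equivalent_categories RB BR"
  unfolding equivalent_categories_def
  using category_RB category_BR brace_of_functor rb_of_functor unit_natural_iso counit_natural_iso
  by blast

end

theorem theorem2p20:
  fixes C :: "('o, 'm) braided_data"
    and H B :: "('o, 'm) hopf_data"
    and T \<phi>H :: 'm
  assumes "braided_cat C"
    and "braided_cat.rel_rota_baxter C H B T \<phi>H"
    and "braided_cat.is_cocommutative C H"
    and "is_iso C T"
  shows "equivalent_categories
           (braided_cat.rb_mod_iso_cat C H B T \<phi>H)
           (braided_cat.brace_mod_cat C (braided_cat.associated_brace C H B T \<phi>H))"
proof -
  interpret braided_cat C by fact
  have "T \<in> hom\<^bsub>C\<^esub> (car H) (car B)"
    using assms(2) by (simp add: rel_rota_baxter_def coalg_morphism_def)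
  with assms(4) obtain S where "S \<in> hom\<^bsub>C\<^esub> (car B) (car H)" "S \<cdot>\<^bsub>C\<^esub> T = \<one>\<^bsub>C\<^esub> (car H)"
    "T \<cdot>\<^bsub>C\<^esub> S = \<one>\<^bsub>C\<^esub> (car B)"
    using is_iso_inverse by blast
  with assms(2) interpret rota_baxter_iso C H B T \<phi>H S
    by unfold_locales
  show ?thesis
    by (rule equivalent)
qed

end
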